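(* The conservation laws for the Noether symmetries of the equation $\Delta_{H^1}u=0$ are the following; in particular, each of the stated divergences vanishes for every smooth solution $u$ of the equation. 1. For $T=\frac{\partial}{\partial t}$, $R=y\frac{\partial}{\partial x}-x\frac{\partial}{\partial y}$, $\tilde X=\frac{\partial}{\partial x}-2y\frac{\partial}{\partial t}$, $\tilde Y=\frac{\partial}{\partial y}+2x\frac{\partial}{\partial t}$, the conservation laws are respectively $\mathrm{Div}(\tau)=0$, $\mathrm{Div}(\sigma)=0$, $\mathrm{Div}(\chi)=0$, $\mathrm{Div}(\upsilon)=0$, where $$\tau_1=-2yu_t^2-u_xu_t,\quad \tau_2=2xu_t^2-u_yu_t,\quad \tau_3=\tfrac12u_x^2+\tfrac12u_y^2-2(x^2+y^2)u_t^2;$$ $$\sigma_1=-\tfrac12yu_x^2+\tfrac12yu_y^2+2y(x^2+y^2)u_t^2+xu_xu_y,$$ $$\sigma_2=-\tfrac12xu_x^2+\tfrac12xu_y^2-2x(x^2+y^2)u_t^2-yu_xu_y,$$ $$\sigma_3=-2y^2u_x^2-2x^2u_y^2+4xyu_xu_y-4y(x^2+y^2)u_xu_t+4x(x^2+y^2)u_yu_t;$$ $$\chi_1=-\tfrac12u_x^2+\tfrac12u_y^2+2(x^2+3y^2)u_t^2+2yu_xu_t-2xu_yu_t,$$ $$\chi_2=-4xyu_t^2-u_xu_y+2xu_xu_t+2yu_yu_t,$$ $$\chi_3=-3yu_x^2-yu_y^2+4y(x^2+y^2)u_t^2+2xu_xu_y-4(x^2+y^2)u_xu_t;$$ $$\upsilon_1=-4xyu_t^2-u_xu_y-2xu_xu_t-2yu_yu_t,$$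 $$\upsilon_2=\tfrac12u_x^2-\tfrac12u_y^2+2(3x^2+y^2)u_t^2+2yu_xu_t-2xu_yu_t,$$ $$\upsilon_3=xu_x^2+3xu_y^2-4x(x^2+y^2)u_t^2-2yu_xu_y-4(x^2+y^2)u_yu_t.$$ 2. For $V_1=(xt-x^2y-y^3)\frac{\partial}{\partial x}+(yt+x^3+xy^2)\frac{\partial}{\partial y}+(t^2-(x^2+y^2)^2)\frac{\partial}{\partial t}-tu\frac{\partial}{\partial u}$, the conservation law is $\mathrm{Div}(A)=0$, where $A=(A_1,A_2,A_3)$ and $$A_1=-\tfrac12(tx-x^2y-y^3)u_x^2+\tfrac12(tx-x^2y-y^3)u_y^2+2t(x^3+xy^2-ty)u_t^2-(x^3+xy^2+ty)u_xu_y$$ $$-[t^2-(x^2+y^2)^2]u_xu_t-2t(x^2+y^2)u_yu_t-tuu_x-2tyuu_t+yu^2,$$ $$A_2=\tfrac12(x^3+ty+xy^2)u_x^2-\tfrac12(x^3+ty+xy^2)u_y^2+2t(x^2y+y^3+tx)u_t^2-(tx-x^2y-y^3)u_xu_y$$ $$+2t(x^2+y^2)u_xu_t-[t^2-(x^2+y^2)^2]u_yu_t-tuu_y+2txuu_t-xu^2,$$ $$A_3=\tfrac12(t^2-x^4-4txy+2x^2y^2+3y^4)u_x^2+\tfrac12(t^2+3x^4+4txy+2x^2y^2-y^4)u_y^2$$ $$-2(x^2+y^2)[t^2-(x^2+y^2)^2]u_t^2+2[t(x^2-y^2)-2xy(x^2+y^2)]u_xu_y$$ $$-4(x^2+y^2)(tx-x^2y-y^3)u_xu_t-4(x^2+y^2)(x^3+ty+xy^2)u_yu_t$$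 $$-2tyuu_x+2txuu_y-4t(x^2+y^2)uu_t+2(x^2+y^2)u^2.$$ 3. For $V_2=(t-4xy)\frac{\partial}{\partial x}+(3x^2-y^2)\frac{\partial}{\partial y}-(2yt+2x^3+2xy^2)\frac{\partial}{\partial t}+2yu\frac{\partial}{\partial u}$, the conservation law is $\mathrm{Div}(B)=0$, where $B=(B_1,B_2,B_3)$ and $$B_1=-\tfrac12(t-4xy)u_x^2+\tfrac12(t-4xy)u_y^2+[2t(x^2+3y^2)-4xy(x^2+y^2)]u_t^2-(3x^2-y^2)u_xu_y$$ $$+2(x^3+ty+xy^2)u_xu_t-2(tx-x^2y-y^3)u_yu_t+2yuu_x+4y^2uu_t,$$ $$B_2=\tfrac12(3x^2-y^2)u_x^2-\tfrac12(3x^2-y^2)u_y^2+2(x^4-2txy-y^4)u_t^2-(t-4xy)u_xu_y$$ $$+2(tx-x^2y-y^3)u_xu_t+2(x^3+ty+xy^2)u_yu_t+2yuu_y-4xyuu_t-u^2,$$ $$B_3=(7xy^2-x^3-3ty)u_x^2+(5x^3-3xy^2-ty)u_y^2+4(x^2+y^2)(x^3+ty+xy^2)u_t^2$$ $$+2(tx-7x^2y+y^3)u_xu_y-4(t-4xy)(x^2+y^2)u_xu_t-4(3x^4+2x^2y^2-y^4)u_yu_t$$ $$+2xu^2+4y^2uu_x-4xyuu_y+8y(x^2+y^2)uu_t.$$ 4. For $V_3=(x^2-3y^2)\frac{\partial}{\partial x}+(t+4xy)\frac{\partial}{\partial y}+(2xt-2x^2y-2y^3)\frac{\partial}{\partial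 t}-2xu\frac{\partial}{\partial u}$, the conservation law is $\mathrm{Div}(C)=0$, where $C=(C_1,C_2,C_3)$ and $$C_1=-\tfrac12(x^2-3y^2)u_x^2+\tfrac12(x^2-3y^2)u_y^2+(2x^4-4txy-2y^4)u_t^2-(t+4xy)u_xu_y$$ $$-(2tx-2x^2y-2y^3)u_xu_t-(2x^3+2ty+2xy^2)u_yu_t-4xyuu_t-2xuu_x+u^2,$$ $$C_2=\tfrac12(t+4xy)u_x^2-\tfrac12(t+4xy)u_y^2+(6tx^2+4x^3y+2ty^2+4xy^3)u_t^2-(x^2-3y^2)u_xu_y$$ $$+2(x^3+ty+xy^2)u_xu_t-2(tx-x^2y-y^3)u_yu_t-2xuu_y+4x^2uu_t,$$ $$C_3=(tx-3x^2y+5y^3)u_x^2+(3tx+7x^2y-y^3)u_y^2+(-4tx^3+4x^4y-4txy^2+8x^2y^3+4y^5)u_t^2$$ $$+2(x^3-ty-7xy^2)u_xu_y-2(2x^4-4x^2y^2-6y^4)u_xu_t-4(x^2+y^2)(t+4xy)u_yu_t$$ $$-8x^3uu_t-8xy^2uu_t+4x^2uu_y-4xyuu_x+2yu^2.$$ 5. For $W_\beta=\beta(x,y,t)\frac{\partial}{\partial u}$, where $\Delta_{H^1}\beta=0$, the conservation law is $\mathrm{Div}(W)=0$, where $W=(W_1,W_2,W_3)$ and $$W_1=\beta(u_x+2yu_t)-u(\beta_x+2y\beta_t),\qquad W_2=\beta(u_y-2xu_t)-u(\beta_y-2x\beta_t),$$ $$W_3=\beta[-2xu_y+2yu_x+4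(x^2+y^2)u_t]+2u[x\beta_y-y\beta_x-2(x^2+y^2)\beta_t].$$
   Context: Coordinates on $\mathbb{R}^3$ (the Heisenberg group $H^1$) are $(x^1,x^2,x^3)=(x,y,t)$, and $u=u(x,y,t)$ is a smooth real-valued function. The Kohn-Laplace operator is $$\Delta_{H^1}u=u_{xx}+u_{yy}+4(x^2+y^2)u_{tt}+4y\,u_{xt}-4x\,u_{yt}.$$ The equation $\Delta_{H^1}u=0$ is the Euler-Lagrange equation of $$\mathcal{L}=\tfrac12u_x^2+\tfrac12u_y^2+2(x^2+y^2)u_t^2+2y\,u_xu_t-2x\,u_yu_t.$$ For $A=(A_1,A_2,A_3)$ depending on $x,y,t,u$ and derivatives of $u$, $\mathrm{Div}(A)=D_xA_1+D_yA_2+D_tA_3$ with $D_x,D_y,D_t$ total derivatives. A Lie point symmetry $S=\xi^i\frac{\partial}{\partial x^i}+\eta\frac{\partial}{\partial u}$ of the equation is a Noether symmetry if $S^{(1)}\mathcal{L}+\mathcal{L}D_i\xi^i=D_i\varphi^i$ identically for some $\varphi=(\varphi^1,\varphi^2,\varphi^3)$, where $S^{(1)}=S+(D_i\eta-(D_i\xi^j)u_j)\frac{\partial}{\partial u_i}$; its conservation law (Noether's theorem) is $D_i\big(\xi^i\mathcal{L}+(\eta-\xi^ju_j)\frac{\partial\mathcal{L}}{\partial u_i}-\varphi^i\big)=0$ on solutions of the equation, for such a $\varphi$. *)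

theory Defs
  imports "HOL-Analysis.Analysis"
begin

section \<open>Smooth functions and jets\<close>

primrec Ck :: "nat \<Rightarrow> ('a::euclidean_space \<Rightarrow> 'b::real_normed_vector) \<Rightarrow> bool" where
  "Ck 0 f \<longleftrightarrow> continuous_on UNIV f"
| "Ck (Suc k) f \<longleftrightarrow>
     (\<forall>x. f differentiable (at x)) \<and> (\<forall>v. Ck k (\<lambda>x. frechet_derivative f (at x) v))"

definition smooth :: "('a::euclidean_space \<Rightarrow> 'b::real_normed_vector) \<Rightarrow> bool" where
  "smooth f \<longleftrightarrow> (\<forall>k. Ck k f)"

definition pd :: "3 \<Rightarrow> (real^3 \<Rightarrow> 'b::real_normed_vector) \<Rightarrow> real^3 \<Rightarrow> 'b" where
  "pd i f X = frechet_derivative f (at X) (axis i 1)"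

text \<open>
  Points of the jet spaces are tuples \<open>(X, u, p, q)\<close>, where \<open>X = (x, y, t)\<close>, \<open>p $ i\<close> is the
  coordinate \<open>u\<^sub>i\<close> and \<open>q $ i $ j\<close> is the coordinate \<open>u\<^sub>i\<^sub>j\<close>. Only symmetric \<open>q\<close> are genuine
  second-order jets; this is imposed wherever one quantifies over second-order jets.
\<close>

type_synonym jet0 = "(real^3) \<times> real"
type_synonym jet1 = "(real^3) \<times> real \<times> (real^3)"
type_synonym jet2 = "(real^3) \<times> real \<times> (real^3) \<times> (real^3^3)"

definition jet2_of :: "(real^3 \<Rightarrow> real) \<Rightarrow> real^3 \<Rightarrow> jet2" where
  "jet2_of u X = (X, u X, (\<chi> i. pd i u X), (\<chi> i j. pd j (pd i u) X))"

definition on_jet0 :: "(real \<Rightarrow> real \<Rightarrow> real \<Rightarrow> real \<Rightarrow> 'b) \<Rightarrow> jet0 \<Rightarrow> 'b" where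
  "on_jet0 f = (\<lambda>(X, u). f (X$1) (X$2) (X$3) u)"

definition on_jet1 ::
    "(real \<Rightarrow> real \<Rightarrow> real \<Rightarrow> real \<Rightarrow> real \<Rightarrow> real \<Rightarrow> real \<Rightarrow> 'b) \<Rightarrow> jet1 \<Rightarrow> 'b" where
  "on_jet1 f = (\<lambda>(X, u, p). f (X$1) (X$2) (X$3) u (p$1) (p$2) (p$3))"

text \<open>
  The total derivative \<open>D\<^sub>i = \<partial>\<^sub>i + u\<^sub>i \<partial>\<^sub>u + u\<^sub>i\<^sub>j \<partial>/\<partial>u\<^sub>j\<close>, acting on functions of order 0 and of order 1,
  written as a directional derivative on the jet space.
\<close>

definition D0 :: "3 \<Rightarrow> (jet0 \<Rightarrow> 'b::real_normed_vector) \<Rightarrow> jet1 \<Rightarrow> 'b" where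
  "D0 i F = (\<lambda>(X, u, p). frechet_derivative F (at (X, u)) (axis i 1, p $ i))"

definition D1 :: "3 \<Rightarrow> (jet1 \<Rightarrow> 'b::real_normed_vector) \<Rightarrow> jet2 \<Rightarrow> 'b" where
  "D1 i F = (\<lambda>(X, u, p, q). frechet_derivative F (at (X, u, p)) (axis i 1, p $ i, q $ i))"

definition Div :: "(jet1 \<Rightarrow> real^3) \<Rightarrow> jet2 \<Rightarrow> real" where
  "Div A z = (\<Sum>i\<in>UNIV. D1 i A z $ i)"


section \<open>Prolongations and Noether symmetries\<close>

text \<open>
  A field \<open>\<xi>\<^sup>i \<partial>\<^sub>i + \<eta> \<partial>\<^sub>u\<close> is represented by the map \<open>S = (\<xi>, \<eta>)\<close> on the jets of order 0.
\<close>

type_synonym field0 = "jet0 \<Rightarrow> (real^3) \<times> real"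

definition xi :: "field0 \<Rightarrow> jet0 \<Rightarrow> real^3" where
  "xi S z = fst (S z)"

definition eta :: "field0 \<Rightarrow> jet0 \<Rightarrow> real" where
  "eta S z = snd (S z)"

text \<open>
  The prolongation coefficients are \<open>\<zeta>\<^sub>i = D\<^sub>i \<eta> - (D\<^sub>i \<xi>\<^sup>j) u\<^sub>j\<close> and
  \<open>\<zeta>\<^sub>i\<^sub>j = D\<^sub>j \<zeta>\<^sub>i - u\<^sub>i\<^sub>k D\<^sub>j \<xi>\<^sup>k\<close>.
\<close>

definition zeta1 :: "field0 \<Rightarrow> jet1 \<Rightarrow> real^3" where
  "zeta1 S = (\<lambda>(X, u, p). \<chi> i.
     D0 i (eta S) (X, u, p) - (\<Sum>j\<in>UNIV. D0 i (xi S) (X, u, p) $ j * p $ j))"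

definition zeta2 :: "field0 \<Rightarrow> jet2 \<Rightarrow> real^3^3" where
  "zeta2 S = (\<lambda>(X, u, p, q). \<chi> i j.
     D1 j (zeta1 S) (X, u, p, q) $ i - (\<Sum>k\<in>UNIV. q $ i $ k * D0 j (xi S) (X, u, p) $ k))"

definition prolong1 :: "field0 \<Rightarrow> (jet1 \<Rightarrow> real) \<Rightarrow> jet1 \<Rightarrow> real" where
  "prolong1 S F = (\<lambda>(X, u, p).
     frechet_derivative F (at (X, u, p)) (xi S (X, u), eta S (X, u), zeta1 S (X, u, p)))"

definition prolong2 :: "field0 \<Rightarrow> (jet2 \<Rightarrow> real) \<Rightarrow> jet2 \<Rightarrow> real" where
  "prolong2 S F = (\<lambda>(X, u, p, q).
     frechet_derivative F (at (X, u, p, q))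
       (xi S (X, u), eta S (X, u), zeta1 S (X, u, p), zeta2 S (X, u, p, q)))"

text \<open>
  Lie point symmetries of the second-order equation \<open>F = 0\<close>, in infinitesimal form: the second
  prolongation of the field annihilates \<open>F\<close> on the locus \<open>F = 0\<close> in the second-order jet space.
\<close>

definition lie_point_symmetry :: "(jet2 \<Rightarrow> real) \<Rightarrow> field0 \<Rightarrow> bool" where
  "lie_point_symmetry F S \<longleftrightarrow> smooth S \<and>
     (\<forall>X u p q. transpose q = q \<longrightarrow> F (X, u, p, q) = 0 \<longrightarrow> prolong2 S F (X, u, p, q) = 0)"

definition noether_identity ::
    "(jet1 \<Rightarrow> real) \<Rightarrow> field0 \<Rightarrow> (jet1 \<Rightarrow> real^3) \<Rightarrow> bool" where
  "noether_identity L S \<phi> \<longleftrightarrow> smooth \<phi> \<and>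
     (\<forall>X u p q. transpose q = q \<longrightarrow>
        prolong1 S L (X, u, p) + L (X, u, p) * (\<Sum>i\<in>UNIV. D0 i (xi S) (X, u, p) $ i)
          = Div \<phi> (X, u, p, q))"

definition noether_symmetry :: "(jet2 \<Rightarrow> real) \<Rightarrow> (jet1 \<Rightarrow> real) \<Rightarrow> field0 \<Rightarrow> bool" where
  "noether_symmetry F L S \<longleftrightarrow> lie_point_symmetry F S \<and> (\<exists>\<phi>. noether_identity L S \<phi>)"

definition noether_current ::
    "(jet1 \<Rightarrow> real) \<Rightarrow> field0 \<Rightarrow> (jet1 \<Rightarrow> real^3) \<Rightarrow> jet1 \<Rightarrow> real^3" where
  "noether_current L S \<phi> = (\<lambda>(X, u, p). \<chi> i.
     xi S (X, u) $ i * L (X, u, p)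
     + (eta S (X, u) - (\<Sum>j\<in>UNIV. xi S (X, u) $ j * p $ j))
         * frechet_derivative L (at (X, u, p)) (0, 0, axis i 1)
     - \<phi> (X, u, p) $ i)"


section \<open>The Kohn-Laplace equation on the Heisenberg group\<close>

definition kohn_laplace :: "jet2 \<Rightarrow> real" where
  "kohn_laplace = (\<lambda>(X, u, p, q). let x = X$1; y = X$2 in
     q$1$1 + q$2$2 + 4 * (x^2 + y^2) * q$3$3 + 4 * y * q$1$3 - 4 * x * q$2$3)"

definition kl_solution :: "(real^3 \<Rightarrow> real) \<Rightarrow> bool" where
  "kl_solution u \<longleftrightarrow> smooth u \<and> (\<forall>X. kohn_laplace (jet2_of u X) = 0)"

definition kl_lagrangian :: "jet1 \<Rightarrow> real" where
  "kl_lagrangian = on_jet1 (\<lambda>x y t u ux uy ut.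
     1/2 * ux^2 + 1/2 * uy^2 + 2 * (x^2 + y^2) * ut^2 + 2 * y * ux * ut - 2 * x * uy * ut)"

text \<open>
  \<open>A\<close> is the Noether conserved vector of the Noether symmetry \<open>S\<close> (for some choice of \<open>\<phi>\<close>), and
  its divergence vanishes on all solutions.
\<close>

definition kl_conservation_law :: "field0 \<Rightarrow> (jet1 \<Rightarrow> real^3) \<Rightarrow> bool" where
  "kl_conservation_law S A \<longleftrightarrow>
     noether_symmetry kohn_laplace kl_lagrangian S \<and>
     (\<exists>\<phi>. noether_identity kl_lagrangian S \<phi> \<and> A = noether_current kl_lagrangian S \<phi>) \<and>
     (\<forall>u. kl_solution u \<longrightarrow> (\<forall>X. Div A (jet2_of u X) = 0))"


section \<open>The symmetries\<close>

definition field_T :: field0 where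
  "field_T = on_jet0 (\<lambda>x y t u. (vector [0, 0, 1], 0))"

definition field_R :: field0 where
  "field_R = on_jet0 (\<lambda>x y t u. (vector [y, - x, 0], 0))"

definition field_X :: field0 where
  "field_X = on_jet0 (\<lambda>x y t u. (vector [1, 0, - 2 * y], 0))"

definition field_Y :: field0 where
  "field_Y = on_jet0 (\<lambda>x y t u. (vector [0, 1, 2 * x], 0))"

definition field_V1 :: field0 where
  "field_V1 = on_jet0 (\<lambda>x y t u.
     (vector [x*t - x^2*y - y^3, y*t + x^3 + x*y^2, t^2 - (x^2 + y^2)^2], - t*u))"

definition field_V2 :: field0 where
  "field_V2 = on_jet0 (\<lambda>x y t u.
     (vector [t - 4*x*y, 3*x^2 - y^2, - (2*y*t + 2*x^3 + 2*x*y^2)], 2*y*u))"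

definition field_V3 :: field0 where
  "field_V3 = on_jet0 (\<lambda>x y t u.
     (vector [x^2 - 3*y^2, t + 4*x*y, 2*x*t - 2*x^2*y - 2*y^3], - 2*x*u))"

definition field_W :: "(real^3 \<Rightarrow> real) \<Rightarrow> field0" where
  "field_W \<beta> = (\<lambda>(X, u). (0, \<beta> X))"


section \<open>The conserved vectors\<close>

definition vec_tau :: "jet1 \<Rightarrow> real^3" where
  "vec_tau = on_jet1 (\<lambda>x y t u ux uy ut. vector [
     - 2*y*ut^2 - ux*ut,
     2*x*ut^2 - uy*ut,
     1/2*ux^2 + 1/2*uy^2 - 2*(x^2 + y^2)*ut^2])"

definition vec_sigma :: "jet1 \<Rightarrow> real^3" where
  "vec_sigma = on_jet1 (\<lambda>x y t u ux uy ut. vector [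
     - 1/2*y*ux^2 + 1/2*y*uy^2 + 2*y*(x^2 + y^2)*ut^2 + x*ux*uy,
     - 1/2*x*ux^2 + 1/2*x*uy^2 - 2*x*(x^2 + y^2)*ut^2 - y*ux*uy,
     - 2*y^2*ux^2 - 2*x^2*uy^2 + 4*x*y*ux*uy - 4*y*(x^2 + y^2)*ux*ut + 4*x*(x^2 + y^2)*uy*ut])"

definition vec_chi :: "jet1 \<Rightarrow> real^3" where
  "vec_chi = on_jet1 (\<lambda>x y t u ux uy ut. vector [
     - 1/2*ux^2 + 1/2*uy^2 + 2*(x^2 + 3*y^2)*ut^2 + 2*y*ux*ut - 2*x*uy*ut,
     - 4*x*y*ut^2 - ux*uy + 2*x*ux*ut + 2*y*uy*ut,
     - 3*y*ux^2 - y*uy^2 + 4*y*(x^2 + y^2)*ut^2 + 2*x*ux*uy - 4*(x^2 + y^2)*ux*ut])"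

definition vec_upsilon :: "jet1 \<Rightarrow> real^3" where
  "vec_upsilon = on_jet1 (\<lambda>x y t u ux uy ut. vector [
     - 4*x*y*ut^2 - ux*uy - 2*x*ux*ut - 2*y*uy*ut,
     1/2*ux^2 - 1/2*uy^2 + 2*(3*x^2 + y^2)*ut^2 + 2*y*ux*ut - 2*x*uy*ut,
     x*ux^2 + 3*x*uy^2 - 4*x*(x^2 + y^2)*ut^2 - 2*y*ux*uy - 4*(x^2 + y^2)*uy*ut])"

definition vec_A :: "jet1 \<Rightarrow> real^3" where
  "vec_A = on_jet1 (\<lambda>x y t u ux uy ut. vector [
     - 1/2*(t*x - x^2*y - y^3)*ux^2 + 1/2*(t*x - x^2*y - y^3)*uy^2
       + 2*t*(x^3 + x*y^2 - t*y)*ut^2 - (x^3 + x*y^2 + t*y)*ux*uy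
       - (t^2 - (x^2 + y^2)^2)*ux*ut - 2*t*(x^2 + y^2)*uy*ut
       - t*u*ux - 2*t*y*u*ut + y*u^2,
     1/2*(x^3 + t*y + x*y^2)*ux^2 - 1/2*(x^3 + t*y + x*y^2)*uy^2
       + 2*t*(x^2*y + y^3 + t*x)*ut^2 - (t*x - x^2*y - y^3)*ux*uy
       + 2*t*(x^2 + y^2)*ux*ut - (t^2 - (x^2 + y^2)^2)*uy*ut
       - t*u*uy + 2*t*x*u*ut - x*u^2,
     1/2*(t^2 - x^4 - 4*t*x*y + 2*x^2*y^2 + 3*y^4)*ux^2
       + 1/2*(t^2 + 3*x^4 + 4*t*x*y + 2*x^2*y^2 - y^4)*uy^2
       - 2*(x^2 + y^2)*(t^2 - (x^2 + y^2)^2)*ut^2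
       + 2*(t*(x^2 - y^2) - 2*x*y*(x^2 + y^2))*ux*uy
       - 4*(x^2 + y^2)*(t*x - x^2*y - y^3)*ux*ut
       - 4*(x^2 + y^2)*(x^3 + t*y + x*y^2)*uy*ut
       - 2*t*y*u*ux + 2*t*x*u*uy - 4*t*(x^2 + y^2)*u*ut + 2*(x^2 + y^2)*u^2])"

definition vec_B :: "jet1 \<Rightarrow> real^3" where
  "vec_B = on_jet1 (\<lambda>x y t u ux uy ut. vector [
     - 1/2*(t - 4*x*y)*ux^2 + 1/2*(t - 4*x*y)*uy^2
       + (2*t*(x^2 + 3*y^2) - 4*x*y*(x^2 + y^2))*ut^2 - (3*x^2 - y^2)*ux*uy
       + 2*(x^3 + t*y + x*y^2)*ux*ut - 2*(t*x - x^2*y - y^3)*uy*ut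
       + 2*y*u*ux + 4*y^2*u*ut,
     1/2*(3*x^2 - y^2)*ux^2 - 1/2*(3*x^2 - y^2)*uy^2
       + 2*(x^4 - 2*t*x*y - y^4)*ut^2 - (t - 4*x*y)*ux*uy
       + 2*(t*x - x^2*y - y^3)*ux*ut + 2*(x^3 + t*y + x*y^2)*uy*ut
       + 2*y*u*uy - 4*x*y*u*ut - u^2,
     (7*x*y^2 - x^3 - 3*t*y)*ux^2 + (5*x^3 - 3*x*y^2 - t*y)*uy^2
       + 4*(x^2 + y^2)*(x^3 + t*y + x*y^2)*ut^2
       + 2*(t*x - 7*x^2*y + y^3)*ux*uy
       - 4*(t - 4*x*y)*(x^2 + y^2)*ux*ut - 4*(3*x^4 + 2*x^2*y^2 - y^4)*uy*ut
       + 2*x*u^2 + 4*y^2*u*ux - 4*x*y*u*uy + 8*y*(x^2 + y^2)*u*ut])"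

definition vec_C :: "jet1 \<Rightarrow> real^3" where
  "vec_C = on_jet1 (\<lambda>x y t u ux uy ut. vector [
     - 1/2*(x^2 - 3*y^2)*ux^2 + 1/2*(x^2 - 3*y^2)*uy^2
       + (2*x^4 - 4*t*x*y - 2*y^4)*ut^2 - (t + 4*x*y)*ux*uy
       - (2*t*x - 2*x^2*y - 2*y^3)*ux*ut - (2*x^3 + 2*t*y + 2*x*y^2)*uy*ut
       - 4*x*y*u*ut - 2*x*u*ux + u^2,
     1/2*(t + 4*x*y)*ux^2 - 1/2*(t + 4*x*y)*uy^2
       + (6*t*x^2 + 4*x^3*y + 2*t*y^2 + 4*x*y^3)*ut^2 - (x^2 - 3*y^2)*ux*uy
       + 2*(x^3 + t*y + x*y^2)*ux*ut - 2*(t*x - x^2*y - y^3)*uy*ut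
       - 2*x*u*uy + 4*x^2*u*ut,
     (t*x - 3*x^2*y + 5*y^3)*ux^2 + (3*t*x + 7*x^2*y - y^3)*uy^2
       + (- 4*t*x^3 + 4*x^4*y - 4*t*x*y^2 + 8*x^2*y^3 + 4*y^5)*ut^2
       + 2*(x^3 - t*y - 7*x*y^2)*ux*uy
       - 2*(2*x^4 - 4*x^2*y^2 - 6*y^4)*ux*ut - 4*(x^2 + y^2)*(t + 4*x*y)*uy*ut
       - 8*x^3*u*ut - 8*x*y^2*u*ut + 4*x^2*u*uy - 4*x*y*u*ux + 2*y*u^2])"

definition vec_W :: "(real^3 \<Rightarrow> real) \<Rightarrow> jet1 \<Rightarrow> real^3" where
  "vec_W \<beta> = (\<lambda>(X, u, p).
     let x = X$1; y = X$2; ux = p$1; uy = p$2; ut = p$3;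
         b = \<beta> X; bx = pd 1 \<beta> X; by' = pd 2 \<beta> X; bt = pd 3 \<beta> X
     in vector [
       b*(ux + 2*y*ut) - u*(bx + 2*y*bt),
       b*(uy - 2*x*ut) - u*(by' - 2*x*bt),
       b*(- 2*x*uy + 2*y*ux + 4*(x^2 + y^2)*ut) + 2*u*(x*by' - y*bx - 2*(x^2 + y^2)*bt)])"

end

theory Submission
  imports Defs
begin

text \<open>
  Noether's identity is used off shell: if \<open>S\<^bsup>(1)\<^esup> L + L D\<^sub>i \<xi>\<^sup>i = D\<^sub>i \<phi>\<^sup>i\<close>, then on every second-order jet the
  divergence of the Noether current equals the characteristic \<open>\<eta> - \<xi>\<^sup>j u\<^sub>j\<close> times the Euler-Lagrange
  expression, which here is the Kohn-Laplace operator. This needs equality of mixed derivatives of \<open>u\<close>.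
  For each field \<open>S\<close> it then suffices to exhibit \<open>\<phi>\<close>, which is quadratic in \<open>u\<close> for \<open>V\<^sub>1, V\<^sub>2, V\<^sub>3\<close>, linear
  for \<open>W\<^sub>\<beta>\<close> and zero otherwise, such that the canonical current is the stated vector, and a function
  \<open>\<mu>\<close> such that the second prolongation of \<open>S\<close> maps the Kohn-Laplace operator to \<open>\<mu>\<close> times itself.
\<close>

section \<open>Calculus of smooth functions\<close>

named_theorems smooth_intros

text \<open>The definition of \<open>Ck (Suc k)\<close> speaks of differentiability and of the
  derivatives, not of \<open>Ck k f\<close> itself. Monotonicity in the order supplies the
  regularity of the undifferentiated factors in the Leibniz rule.\<close>

lemma Ck_Suc_imp_Ck:
  assumes "Ck (Suc k) f"
  shows "Ck k f"
  using assms
proof (induction k arbitrary: f)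
  case 0
  then show ?case
    by (simp add: continuous_at_imp_continuous_on differentiable_imp_continuous_within)
next
  case (Suc k)
  from iffD1[OF Ck.simps(2) Suc.prems]
  have d: "f differentiable (at x)" and D: "Ck (Suc k) (\<lambda>x. frechet_derivative f (at x) v)" for x v
    by blast+
  from d Suc.IH[OF D] show ?case by simp
qed

lemma smooth_imp_differentiable: "smooth f \<Longrightarrow> f differentiable (at x)"
  unfolding smooth_def by (metis Ck.simps(2))

lemma smooth_has_derivative:
  "smooth f \<Longrightarrow> (f has_derivative frechet_derivative f (at x)) (at x)"
  using smooth_imp_differentiable frechet_derivative_works by blast

lemma smooth_frechet_derivative [smooth_intros]:
  "smooth f \<Longrightarrow> smooth (\<lambda>x. frechet_derivative f (at x) v)"
  unfolding smooth_def by (metis Ck.simps(2))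

lemma smooth_pd [smooth_intros]: "smooth f \<Longrightarrow> smooth (pd i f)"
  unfolding pd_def[abs_def] by (rule smooth_frechet_derivative)

lemma smooth_imp_continuous: "smooth f \<Longrightarrow> isCont f x"
  using smooth_imp_differentiable differentiable_imp_continuous_within by blast

section \<open>Closure of smoothness under algebraic operations and linear maps\<close>

lemma Ck_const: "Ck k (\<lambda>x. c)"
  by (induction k arbitrary: c) auto

lemma smooth_const [smooth_intros]: "smooth (\<lambda>x. c)"
  by (simp add: smooth_def Ck_const)

text \<open>A bounded linear map is its own derivative at every point, so its directional
  derivatives are constant in the base point.\<close>

lemma smooth_bounded_linear:
  assumes "bounded_linear f"
  shows "smooth f"
  unfolding smooth_def
proof
  fix k
  have d: "frechet_derivative f (at x) = f" for x
    using assms bounded_linear_imp_has_derivative frechet_derivative_at by metis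
  show "Ck k f"
    using assms by (cases k)
      (auto simp: linear_continuous_on bounded_linear_imp_differentiable d Ck_const)
qed

lemma Ck_add:
  assumes "Ck k f" "Ck k g"
  shows "Ck k (\<lambda>x. f x + g x)"
  using assms
proof (induction k arbitrary: f g)
  case 0
  then show ?case by (auto intro: continuous_on_add)
next
  case (Suc k)
  have "frechet_derivative (\<lambda>x. f x + g x) (at x) =
      (\<lambda>v. frechet_derivative f (at x) v + frechet_derivative g (at x) v)" for x
    using Suc.prems by (intro frechet_derivative_at[symmetric] derivative_intros)
      (auto simp: frechet_derivative_works)
  with Suc.prems show ?case by (auto intro!: Suc.IH)
qed

lemma smooth_add [smooth_intros]: "smooth f \<Longrightarrow> smooth g \<Longrightarrow> smooth (\<lambda>x. f x + g x)"
  by (simp add: smooth_def Ck_add)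

text \<open>Leibniz rule: a directional derivative is a sum of two products, each with one
  differentiated factor. The general bilinear product covers scalar multiplication, ring
  multiplication and linear images at once.\<close>

lemma (in bounded_bilinear) Ck_prod:
  assumes "Ck k f" "Ck k g"
  shows "Ck k (\<lambda>x. prod (f x) (g x))"
  using assms
proof (induction k arbitrary: f g)
  case 0
  then show ?case by (auto intro: continuous_on)
next
  case (Suc k)
  have "((\<lambda>x. prod (f x) (g x)) has_derivative
      (\<lambda>v. prod (f x) (frechet_derivative g (at x) v) + prod (frechet_derivative f (at x) v) (g x))) (at x)" for x
    using Suc.prems by (intro FDERIV) (auto simp: frechet_derivative_works)
  from frechet_derivative_at[OF this, symmetric] this
  have d: "frechet_derivative (\<lambda>x. prod (f x) (g x)) (at x) =
      (\<lambda>v. prod (f x) (frechet_derivative g (at x) v) + prod (frechet_derivative f (at x) v) (g x))"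
    and "(\<lambda>x. prod (f x) (g x)) differentiable (at x)" for x
    by (auto simp: differentiable_def)
  moreover have "Ck k f" "Ck k g"
    using Suc.prems Ck_Suc_imp_Ck by blast+
  ultimately show ?case
    using Suc.prems by (auto intro!: Ck_add Suc.IH)
qed

lemma (in bounded_bilinear) smooth_prod:
  "smooth f \<Longrightarrow> smooth g \<Longrightarrow> smooth (\<lambda>x. prod (f x) (g x))"
  by (simp add: smooth_def Ck_prod)

lemmas smooth_scaleR [smooth_intros] = bounded_bilinear.smooth_prod[OF bounded_bilinear_scaleR]
lemmas smooth_mult [smooth_intros] = bounded_bilinear.smooth_prod[OF bounded_bilinear_mult]

lemma smooth_linear_image:
  assumes "bounded_linear h" "smooth f"
  shows "smooth (\<lambda>x. h (f x))"
proof -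
  interpret h: bounded_linear h by fact
  \<comment> \<open>A linear image is the bilinear product (c, y) to c h(y) taken at the constant c
    = 1, so no separate induction is needed.\<close>
  have "bounded_bilinear (\<lambda>(c::real) y. c *\<^sub>R h y)"
    using bounded_bilinear.comp[OF bounded_bilinear_scaleR bounded_linear_ident assms(1)] .
  from bounded_bilinear.smooth_prod[OF this smooth_const[of 1] assms(2)] show ?thesis
    by simp
qed

lemmas smooth_minus [smooth_intros] = smooth_linear_image[OF bounded_linear_minus[OF bounded_linear_ident]]
lemmas smooth_fst [smooth_intros] = smooth_linear_image[OF bounded_linear_fst]
lemmas smooth_snd [smooth_intros] = smooth_linear_image[OF bounded_linear_snd]
lemmas smooth_vec_nth [smooth_intros] = smooth_linear_image[OF bounded_linear_vec_nth]
lemmas smooth_ident [smooth_intros] = smooth_bounded_linear[OF bounded_linear_ident]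

lemma smooth_diff [smooth_intros]: "smooth f \<Longrightarrow> smooth g \<Longrightarrow> smooth (\<lambda>x. f x - g x)"
  using smooth_add[of f "\<lambda>x. - g x"] smooth_minus[of g] by simp

lemma smooth_power [smooth_intros]:
  fixes f :: "'a::euclidean_space \<Rightarrow> 'b::{real_normed_algebra, monoid_mult}"
  shows "smooth f \<Longrightarrow> smooth (\<lambda>x. f x ^ n)"
  by (induction n) (auto intro: smooth_const smooth_mult)

lemma smooth_sum [smooth_intros]:
  "(\<And>i. i \<in> I \<Longrightarrow> smooth (f i)) \<Longrightarrow> smooth (\<lambda>x. \<Sum>i\<in>I. f i x)"
  by (induction I rule: infinite_finite_induct) (auto intro: smooth_const smooth_add)

lemma smooth_Pair [smooth_intros]:
  assumes "smooth f" "smooth g"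
  shows "smooth (\<lambda>x. (f x, g x))"
proof -
  have l: "bounded_linear (\<lambda>y. (y, 0))" and r: "bounded_linear (\<lambda>y. (0, y))"
    by (intro bounded_linear_Pair bounded_linear_ident bounded_linear_zero)+
  show ?thesis
    using smooth_add[OF smooth_linear_image[OF l assms(1)] smooth_linear_image[OF r assms(2)]] by simp
qed

lemma smooth_vec_lambda [smooth_intros]:
  fixes f :: "'n::finite \<Rightarrow> 'a::euclidean_space \<Rightarrow> real"
  assumes "\<And>i. smooth (f i)"
  shows "smooth (\<lambda>x. \<chi> i. f i x)"
proof -
  have "(\<chi> i. f i x) = (\<Sum>i\<in>UNIV. f i x *\<^sub>R axis i 1)" for x
    using basis_expansion[of "\<chi> i. f i x"] by (simp add: scalar_mult_eq_scaleR)
  then have "(\<lambda>x. \<chi> i. f i x) = (\<lambda>x. \<Sum>i\<in>UNIV. f i x *\<^sub>R axis i 1)"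
    by (rule ext)
  then show ?thesis
    by (simp only:) (intro smooth_sum smooth_scaleR smooth_const assms)
qed

lemma smooth_vector_3 [smooth_intros]:
  fixes a b c :: "'a::euclidean_space \<Rightarrow> real"
  assumes "smooth a" "smooth b" "smooth c"
  shows "smooth (\<lambda>x. vector [a x, b x, c x] :: real^3)"
proof -
  have "smooth (if i = 1 then a else if i = 2 then b else c)" for i :: 3
    using assms by simp
  then have "smooth (\<lambda>x. \<chi> i::3. (if i = 1 then a else if i = 2 then b else c) x)"
    by (rule smooth_vec_lambda)
  moreover have "(\<lambda>x. \<chi> i::3. (if i = 1 then a else if i = 2 then b else c) x) = (\<lambda>x. vector [a x, b x, c x])"
    by (simp add: fun_eq_iff vec_eq_iff forall_3)
  ultimately show ?thesis by simp
qed

text \<open>For a linear inner map the chain rule only changes the direction from \<open>v\<close>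
  to the fixed \<open>h v\<close>, so the derivatives are again functions composed with
  \<open>h\<close> and the induction closes.\<close>

lemma Ck_linear_arg:
  assumes "bounded_linear h" "Ck k f"
  shows "Ck k (\<lambda>x. f (h x))"
  using assms(2)
proof (induction k arbitrary: f)
  case 0
  then show ?case
    using continuous_on_compose2[of UNIV f UNIV h] linear_continuous_on[OF assms(1)] by simp
next
  case (Suc k)
  have "((\<lambda>x. f (h x)) has_derivative (\<lambda>v. frechet_derivative f (at (h x)) (h v))) (at x)" for x
    by (rule has_derivative_compose[OF bounded_linear_imp_has_derivative[OF assms(1)]])
      (use Suc.prems in \<open>simp add: frechet_derivative_works[symmetric]\<close>)
  note d = this
  have "frechet_derivative (\<lambda>x. f (h x)) (at x) v = frechet_derivative f (at (h x)) (h v)" for x v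
    using frechet_derivative_at[OF d] by metis
  moreover have "(\<lambda>x. f (h x)) differentiable (at x)" for x
    using d by (auto simp: differentiable_def)
  moreover have "Ck k (\<lambda>x. frechet_derivative f (at (h x)) (h v))" for v
    using Suc.prems by (intro Suc.IH) simp
  ultimately show ?case by simp
qed

lemma smooth_linear_arg: "bounded_linear h \<Longrightarrow> smooth f \<Longrightarrow> smooth (\<lambda>x. f (h x))"
  by (simp add: smooth_def Ck_linear_arg)

lemmas smooth_comp_fst = smooth_linear_arg[OF bounded_linear_fst]

text \<open>Pulls functions on jets of order 0 back to jets of order 1, as happens to the
  coefficients of a field inside the Noether current.\<close>

lemma smooth_comp_base:
  fixes f :: "'a::euclidean_space \<times> 'b::euclidean_space \<Rightarrow> 'c::real_normed_vector"
  assumes "smooth f"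
  shows "smooth (\<lambda>z :: 'a \<times> 'b \<times> 'd::euclidean_space. f (fst z, fst (snd z)))"
proof -
  have "bounded_linear (\<lambda>z :: 'a \<times> 'b \<times> 'd. (fst z, fst (snd z)))"
    by (intro bounded_linear_Pair bounded_linear_fst
        bounded_linear_compose[OF bounded_linear_fst bounded_linear_snd])
  from smooth_linear_arg[OF this assms] show ?thesis .
qed

text \<open>
  Apply the mean value theorem to the increment in direction \<open>w\<close> as a function along \<open>v\<close>, and
  then once more along \<open>w\<close>.
\<close>

lemma second_difference_mean_value:
  fixes f :: "'a::euclidean_space \<Rightarrow> real"
  assumes f: "smooth f" and s: "0 < s"
  obtains a b where "0 < a" "a < s" "0 < b" "b < s"
    "f (x + s *\<^sub>R v + s *\<^sub>R w) - f (x + s *\<^sub>R v) - f (x + s *\<^sub>R w) + f x =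
      s * s * frechet_derivative (\<lambda>y. frechet_derivative f (at y) v) (at (x + a *\<^sub>R v + b *\<^sub>R w)) w"
proof -
  have line: "((\<lambda>r. g (y + r *\<^sub>R e)) has_real_derivative frechet_derivative g (at (y + r *\<^sub>R e)) e) (at r)"
    if "smooth g" for g :: "'a \<Rightarrow> real" and y e r
  proof -
    let ?G = "frechet_derivative g (at (y + r *\<^sub>R e))"
    have "((\<lambda>r. y + r *\<^sub>R e) has_derivative (\<lambda>t. t *\<^sub>R e)) (at r)"
      by (auto intro!: derivative_eq_intros)
    from has_derivative_compose[OF this smooth_has_derivative[OF that]]
    have "((\<lambda>r. g (y + r *\<^sub>R e)) has_derivative (\<lambda>t. ?G (t *\<^sub>R e))) (at r)" .
    moreover have "(\<lambda>t. ?G (t *\<^sub>R e)) = (*) (?G e)"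
      using linear_cmul[OF linear_frechet_derivative[OF smooth_imp_differentiable[OF that]]]
      by (simp add: fun_eq_iff mult.commute)
    ultimately show ?thesis
      by (simp add: has_field_derivative_def)
  qed
  let ?g = "\<lambda>y. frechet_derivative f (at y) v"
  have g: "smooth ?g" using f by (rule smooth_frechet_derivative)
  have "((\<lambda>r. f ((x + s *\<^sub>R w) + r *\<^sub>R v) - f (x + r *\<^sub>R v)) has_real_derivative
      ?g ((x + s *\<^sub>R w) + r *\<^sub>R v) - ?g (x + r *\<^sub>R v)) (at r)" for r
    by (rule DERIV_diff[OF line[OF f] line[OF f]])
  from MVT2[OF s this] obtain a where a: "0 < a" "a < s"
    "f (x + s *\<^sub>R v + s *\<^sub>R w) - f (x + s *\<^sub>R v) - f (x + s *\<^sub>R w) + f x =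
      s * (?g ((x + a *\<^sub>R v) + s *\<^sub>R w) - ?g (x + a *\<^sub>R v))"
    by (auto simp: add_ac)
  from MVT2[OF s line[OF g, of "x + a *\<^sub>R v" w]] obtain b where "0 < b" "b < s"
    "?g ((x + a *\<^sub>R v) + s *\<^sub>R w) - ?g (x + a *\<^sub>R v) =
      s * frechet_derivative ?g (at (x + a *\<^sub>R v + b *\<^sub>R w)) w"
    by auto
  with a show ?thesis
    by (intro that[of a b]) auto
qed

text \<open>The second difference of f is symmetric in v and w. By the mean value lemma it is s^2
  times either mixed derivative at a point near x, and both mixed derivatives are continuous at
  x.\<close>

lemma symmetric_second_derivative:
  fixes f :: "'a::euclidean_space \<Rightarrow> real"
  assumes f: "smooth f"
  shows "frechet_derivative (\<lambda>y. frechet_derivative f (at y) v) (at x) w =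
    frechet_derivative (\<lambda>y. frechet_derivative f (at y) w) (at x) v"
proof -
  define H where "H v w y = frechet_derivative (\<lambda>y. frechet_derivative f (at y) v) (at y) w" for v w y
  \<comment> \<open>Intermediate points of the mean value theorem are known only to have parameters
    in (0, s), so the estimate is made uniform over all of these.\<close>
  have close: "\<forall>\<^sub>F s in at_right 0. \<forall>a b. 0 < a \<and> a < s \<and> 0 < b \<and> b < s \<longrightarrow>
      \<bar>H v w (x + a *\<^sub>R v + b *\<^sub>R w) - H v w x\<bar> < e" if "0 < e" for e v w
  proof -
    have "smooth (H v w)"
      unfolding H_def by (intro smooth_intros f)
    then obtain d where d: "0 < d" "\<And>y. dist y x < d \<Longrightarrow> dist (H v w y) (H v w x) < e"
      using smooth_imp_continuous[of "H v w" x] \<open>0 < e\<close> unfolding continuous_at_eps_delta by metis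
    \<comment> \<open>The summand 1 keeps \<open>?c\<close> positive even for v = w = 0 and makes
      the norm estimate below strict.\<close>
    let ?c = "norm v + norm w + 1"
    have "\<forall>\<^sub>F s in at_right 0. s < d / ?c"
      using d(1) by (intro eventually_at_rightI[of 0 "d / ?c"])
        (auto intro!: divide_pos_pos add_nonneg_pos)
    then show ?thesis
    proof eventually_elim
      case (elim s)
      show ?case
      proof (intro allI impI)
        fix a b :: real
        assume ab: "0 < a \<and> a < s \<and> 0 < b \<and> b < s"
        have "norm (a *\<^sub>R v + b *\<^sub>R w) \<le> a * norm v + b * norm w"
          using norm_triangle_ineq[of "a *\<^sub>R v" "b *\<^sub>R w"] ab by simp
        also have "\<dots> \<le> s * norm v + s * norm w"
          using ab by (intro add_mono mult_right_mono) auto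
        also have "\<dots> < s * ?c"
          using ab by (simp add: algebra_simps)
        also have "\<dots> < d"
          using elim by (simp add: pos_less_divide_eq add_nonneg_pos)
        finally show "\<bar>H v w (x + a *\<^sub>R v + b *\<^sub>R w) - H v w x\<bar> < e"
          using d(2)[of "x + a *\<^sub>R v + b *\<^sub>R w"] by (simp add: dist_norm add.assoc)
      qed
    qed
  qed
  have "\<bar>H v w x - H w v x\<bar> \<le> 0 + e" if "0 < e" for e
  proof -
    have "0 < e / 2" using that by simp
    have "\<forall>\<^sub>F s in at_right (0::real). \<bar>H v w x - H w v x\<bar> \<le> e"
      using close[OF \<open>0 < e / 2\<close>, of v w] close[OF \<open>0 < e / 2\<close>, of w v]
        eventually_at_right_less[of 0]
    proof eventually_elim
      case (elim s)
      obtain a b where 1: "0 < a" "a < s" "0 < b" "b < s"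
        "f (x + s *\<^sub>R v + s *\<^sub>R w) - f (x + s *\<^sub>R v) - f (x + s *\<^sub>R w) + f x =
          s * s * H v w (x + a *\<^sub>R v + b *\<^sub>R w)"
        using second_difference_mean_value[OF f elim(3)] unfolding H_def by metis
      obtain a' b' where 2: "0 < a'" "a' < s" "0 < b'" "b' < s"
        "f (x + s *\<^sub>R w + s *\<^sub>R v) - f (x + s *\<^sub>R w) - f (x + s *\<^sub>R v) + f x =
          s * s * H w v (x + a' *\<^sub>R w + b' *\<^sub>R v)"
        using second_difference_mean_value[OF f elim(3)] unfolding H_def by metis
      have "s * s * H v w (x + a *\<^sub>R v + b *\<^sub>R w) = s * s * H w v (x + a' *\<^sub>R w + b' *\<^sub>R v)"
        using 1(5) 2(5) by (simp add: algebra_simps)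
      then have "H v w (x + a *\<^sub>R v + b *\<^sub>R w) = H w v (x + a' *\<^sub>R w + b' *\<^sub>R v)"
        using elim(3) by simp
      moreover have "\<bar>H v w (x + a *\<^sub>R v + b *\<^sub>R w) - H v w x\<bar> < e / 2"
        "\<bar>H w v (x + a' *\<^sub>R w + b' *\<^sub>R v) - H w v x\<bar> < e / 2"
        using elim 1 2 by blast+
      ultimately show ?case by linarith
    qed
    \<comment> \<open>The bound does not involve s, so holding eventually along a nontrivial filter
      means holding.\<close>
    then show ?thesis
      by (simp add: trivial_limit_at_right_real)
  qed
  then have "\<bar>H v w x - H w v x\<bar> \<le> 0" by (rule field_le_epsilon)
  then show ?thesis by (simp add: H_def)
qed

lemma pd_commute:
  fixes f :: "real^3 \<Rightarrow> real"
  shows "smooth f \<Longrightarrow> pd i (pd j f) X = pd j (pd i f) X"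
  using symmetric_second_derivative[of f "axis j 1" X "axis i 1"]
  by (simp add: pd_def[abs_def])

section \<open>Partial derivatives\<close>

named_theorems pd_simps

lemma pd_eqI: "(f has_derivative f') (at X) \<Longrightarrow> pd i f X = f' (axis i 1)"
  unfolding pd_def by (metis frechet_derivative_at)

text \<open>The rules for \<open>pd\<close> equate functions rather than values, so that they also
  rewrite below an outer \<open>pd\<close> in second derivatives.\<close>

lemma pd_const [pd_simps]: "pd i (\<lambda>X. c) = (\<lambda>X. 0)"
  by (simp add: pd_def fun_eq_iff)

lemma pd_coordinate [pd_simps]: "pd i (\<lambda>X. X $ k) = (\<lambda>X. if k = i then 1 else 0)"
  by (rule ext, subst pd_eqI[OF bounded_linear_imp_has_derivative[OF bounded_linear_vec_nth]]) (simp add: axis_def)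

lemma pd_add [pd_simps]:
  "smooth f \<Longrightarrow> smooth g \<Longrightarrow> pd i (\<lambda>X. f X + g X) = (\<lambda>X. pd i f X + pd i g X)"
  by (rule ext, subst pd_eqI[OF has_derivative_add[OF smooth_has_derivative smooth_has_derivative]]) (simp_all add: pd_def)

lemma pd_diff [pd_simps]:
  "smooth f \<Longrightarrow> smooth g \<Longrightarrow> pd i (\<lambda>X. f X - g X) = (\<lambda>X. pd i f X - pd i g X)"
  by (rule ext, subst pd_eqI[OF has_derivative_diff[OF smooth_has_derivative smooth_has_derivative]]) (simp_all add: pd_def)

lemma pd_minus [pd_simps]: "smooth f \<Longrightarrow> pd i (\<lambda>X. - f X) = (\<lambda>X. - pd i f X)"
  by (rule ext, subst pd_eqI[OF has_derivative_minus[OF smooth_has_derivative]]) (simp_all add: pd_def)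

lemma pd_mult [pd_simps]:
  fixes f g :: "real^3 \<Rightarrow> real"
  shows "smooth f \<Longrightarrow> smooth g \<Longrightarrow> pd i (\<lambda>X. f X * g X) = (\<lambda>X. f X * pd i g X + pd i f X * g X)"
  by (rule ext, subst pd_eqI[OF has_derivative_mult[OF smooth_has_derivative smooth_has_derivative]]) (simp_all add: pd_def)

lemma pd_power [pd_simps]:
  fixes f :: "real^3 \<Rightarrow> real"
  shows "smooth f \<Longrightarrow> pd i (\<lambda>X. f X ^ n) = (\<lambda>X. of_nat n * (pd i f X * f X ^ (n - 1)))"
  by (rule ext, subst pd_eqI[OF has_derivative_power[OF smooth_has_derivative]]) (simp_all add: pd_def)

lemma pd_nth [pd_simps]:
  fixes f :: "real^3 \<Rightarrow> real^'n"
  shows "smooth f \<Longrightarrow> pd i (\<lambda>X. f X $ k) = (\<lambda>X. pd i f X $ k)"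
  by (rule ext, subst pd_eqI[OF bounded_linear.has_derivative[OF bounded_linear_vec_nth smooth_has_derivative]]) (simp_all add: pd_def)

lemma pd_vector_3 [pd_simps]:
  fixes a b c :: "real^3 \<Rightarrow> real"
  assumes "smooth a" "smooth b" "smooth c"
  shows "pd i (\<lambda>X. vector [a X, b X, c X] :: real^3) = (\<lambda>X. vector [pd i a X, pd i b X, pd i c X])"
  using pd_nth[OF smooth_vector_3[OF assms], of i, symmetric]
  by (simp add: fun_eq_iff vec_eq_iff forall_3)

section \<open>Noether's theorem\<close>

lemma D0_eqI: "(F has_derivative F') (at (X, u)) \<Longrightarrow> D0 i F (X, u, p) = F' (axis i 1, p $ i)"
  unfolding D0_def by (simp add: frechet_derivative_at[symmetric])

lemma D1_eqI: "(F has_derivative F') (at (X, u, p)) \<Longrightarrow> D1 i F (X, u, p, q) = F' (axis i 1, p $ i, q $ i)"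
  unfolding D1_def by (simp add: frechet_derivative_at[symmetric])

text \<open>\<open>Div\<close> takes components after differentiating a vector; this passes to
  scalar components, where the product rule applies.\<close>

lemma D1_nth:
  fixes A :: "jet1 \<Rightarrow> real^'n"
  assumes "smooth A"
  shows "D1 i A (X, u, p, q) $ k = D1 i (\<lambda>z. A z $ k) (X, u, p, q)"
  using D1_eqI[OF bounded_linear.has_derivative[OF bounded_linear_vec_nth smooth_has_derivative[OF assms]]]
  by (simp add: D1_def)

lemma smooth_has_derivative_fst:
  "smooth f \<Longrightarrow> ((\<lambda>z. f (fst z)) has_derivative (\<lambda>h. frechet_derivative f (at (fst z)) (fst h))) (at z)"
  by (rule has_derivative_compose[OF has_derivative_fst[OF has_derivative_ident] smooth_has_derivative])

lemma has_derivative_nth: "(f has_derivative f') F \<Longrightarrow> ((\<lambda>x. f x $ i) has_derivative (\<lambda>h. f' h $ i)) F"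
  by (rule bounded_linear.has_derivative[OF bounded_linear_vec_nth])

lemma smooth_xi: "smooth S \<Longrightarrow> smooth (xi S)"
  unfolding xi_def[abs_def] by (rule smooth_fst)

lemma smooth_eta: "smooth S \<Longrightarrow> smooth (eta S)"
  unfolding eta_def[abs_def] by (rule smooth_snd)

text \<open>Applied to the derivative of a Lagrangian, this splits it into the partial derivatives
  in x^i, in u and in u_i.\<close>

lemma linear_jet1_expand:
  fixes F :: "(real^3) \<times> real \<times> (real^3) \<Rightarrow> real"
  assumes "linear F"
  shows "F (a, b, c) = (\<Sum>i\<in>UNIV. a $ i * F (axis i 1, 0, 0)) + b * F (0, 1, 0)
    + (\<Sum>i\<in>UNIV. c $ i * F (0, 0, axis i 1))"
proof -
  have "(a, b, c) = (\<Sum>i\<in>UNIV. a $ i *\<^sub>R (axis i 1, 0, 0)) + b *\<^sub>R (0, 1, 0)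
      + (\<Sum>i\<in>UNIV. c $ i *\<^sub>R (0, 0, axis i 1))"
    by (simp add: sum_3 vec_eq_iff forall_3 axis_def)
  then show ?thesis
    by (simp only: linear_add[OF assms] linear_sum[OF assms] linear_cmul[OF assms] real_scaleR_def)
qed

lemma transpose_eq_selfD: "transpose q = q \<Longrightarrow> q $ i $ j = q $ j $ i"
  by (metis transpose_def vec_lambda_beta)

text \<open>
  Noether's theorem in its off-shell form: along every second-order jet the divergence of the
  Noether current is the characteristic times the Euler-Lagrange expression.
\<close>

theorem Div_noether_current:
  assumes S: "smooth S" and L: "smooth L" and N: "noether_identity L S \<phi>" and q: "transpose q = q"
  shows "Div (noether_current L S \<phi>) (X, u, p, q) =
    (eta S (X, u) - (\<Sum>j\<in>UNIV. xi S (X, u) $ j * p $ j)) *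
    ((\<Sum>i\<in>UNIV. D1 i (\<lambda>z. frechet_derivative L (at z) (0, 0, axis i 1)) (X, u, p, q))
      - frechet_derivative L (at (X, u, p)) (0, 1, 0))"
proof -
  define P where "P i z = frechet_derivative L (at z) (0, 0, axis i 1)" for i :: 3 and z
  define J where "J = noether_current L S \<phi>"
  define x where "x = xi S (X, u)"
  define Q where "Q = eta S (X, u) - (\<Sum>j\<in>UNIV. x $ j * p $ j)"
  have \<phi>: "smooth \<phi>" using N by (simp add: noether_identity_def)
  have P: "smooth (P i)" for i unfolding P_def using L by (rule smooth_frechet_derivative)
  let ?b = "\<lambda>z :: jet1. (fst z, fst (snd z))"
  \<comment> \<open>Written with projections of a single jet variable, the current is accessible to
    the derivative rules.\<close>
  have J_eq: "J = (\<lambda>z. \<chi> k. xi S (?b z) $ k * L z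
      + (eta S (?b z) - (\<Sum>j\<in>UNIV. xi S (?b z) $ j * snd (snd z) $ j)) * P k z - \<phi> z $ k)"
    by (auto simp: J_def noether_current_def P_def fun_eq_iff)
  have sx: "smooth (\<lambda>z :: jet1. xi S (?b z))" and se: "smooth (\<lambda>z :: jet1. eta S (?b z))"
    using S by (auto intro: smooth_comp_base smooth_xi smooth_eta)
  have J: "smooth J"
    unfolding J_eq by (intro smooth_intros sx se L P \<phi>)
  have base: "(?b has_derivative ?b) (at z)" for z
    by (intro has_derivative_Pair has_derivative_fst has_derivative_snd has_derivative_ident)
  \<comment> \<open>Product rule. Total derivatives of \<xi> and \<eta> reduce to \<open>D0\<close>,
    since these depend only on the base point, while D_i u_j contributes
    \<open>q $ i $ j\<close>.\<close>
  have DJ: "D1 i J (X, u, p, q) $ i =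
      x $ i * D1 i L (X, u, p, q) + D0 i (xi S) (X, u, p) $ i * L (X, u, p)
      + (Q * D1 i (P i) (X, u, p, q)
        + (D0 i (eta S) (X, u, p) - (\<Sum>j\<in>UNIV. x $ j * q $ i $ j + D0 i (xi S) (X, u, p) $ j * p $ j)) * P i (X, u, p))
      - D1 i \<phi> (X, u, p, q) $ i" for i
  proof -
    let ?z = "(X, u, p)"
    have 1: "((\<lambda>z. xi S (?b z) $ j) has_derivative
        (\<lambda>h. frechet_derivative (xi S) (at (?b ?z)) (?b h) $ j)) (at ?z)" for j
      by (rule has_derivative_nth[OF has_derivative_compose[OF base smooth_has_derivative[OF smooth_xi[OF S]]]])
    have 2: "((\<lambda>z. eta S (?b z)) has_derivative
        (\<lambda>h. frechet_derivative (eta S) (at (?b ?z)) (?b h))) (at ?z)"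
      by (rule has_derivative_compose[OF base smooth_has_derivative[OF smooth_eta[OF S]]])
    have 3: "((\<lambda>z. snd (snd z) $ j) has_derivative (\<lambda>h. snd (snd h) $ j)) (at ?z)" for j
      by (intro has_derivative_nth has_derivative_snd has_derivative_ident)
    note d = has_derivative_diff[OF has_derivative_add[OF
          has_derivative_mult[OF 1 smooth_has_derivative[OF L]]
          has_derivative_mult[OF
            has_derivative_diff[OF 2 has_derivative_sum[OF has_derivative_mult[OF 1 3]]]
            smooth_has_derivative[OF P]]]
        has_derivative_nth[OF smooth_has_derivative[OF \<phi>]]]
    have "D1 i J (X, u, p, q) $ i = D1 i (\<lambda>z. J z $ i) (X, u, p, q)"
      by (rule D1_nth[OF J])
    also have "\<dots> = x $ i * frechet_derivative L (at ?z) (axis i 1, p $ i, q $ i)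
        + frechet_derivative (xi S) (at (X, u)) (axis i 1, p $ i) $ i * L ?z
        + (Q * frechet_derivative (P i) (at ?z) (axis i 1, p $ i, q $ i)
          + (frechet_derivative (eta S) (at (X, u)) (axis i 1, p $ i)
            - (\<Sum>j\<in>UNIV. x $ j * q $ i $ j + frechet_derivative (xi S) (at (X, u)) (axis i 1, p $ i) $ j * p $ j)) * P i ?z)
        - frechet_derivative \<phi> (at ?z) (axis i 1, p $ i, q $ i) $ i"
      unfolding J_eq vec_lambda_beta
      by (subst D1_eqI[OF d]) (simp add: x_def Q_def)
    finally show ?thesis
      by (simp add: D0_def D1_def)
  qed
  let ?L = "frechet_derivative L (at (X, u, p))"
  have lin: "?L (a, b, c) = (\<Sum>i\<in>UNIV. a $ i * ?L (axis i 1, 0, 0)) + b * ?L (0, 1, 0)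
      + (\<Sum>i\<in>UNIV. c $ i * P i (X, u, p))" for a b c
    unfolding P_def
    by (rule linear_jet1_expand[OF linear_frechet_derivative[OF smooth_imp_differentiable[OF L]]])
  have DL: "D1 i L (X, u, p, q) =
      ?L (axis i 1, 0, 0) + p $ i * ?L (0, 1, 0) + (\<Sum>j\<in>UNIV. q $ i $ j * P j (X, u, p))" for i
  proof -
    have "(\<Sum>j\<in>UNIV. axis i 1 $ j * G j) = G i" for G :: "3 \<Rightarrow> real"
      by (simp add: axis_def if_distrib[of "\<lambda>c. c * _"] cong: if_cong)
    then show ?thesis
      using lin[of "axis i 1" "p $ i" "q $ i"] by (simp add: D1_def)
  qed
  \<comment> \<open>Symmetry cancels the second-order terms: \<xi>^i u_ij L_{u_j} arises from D_i L,
    and \<xi>^j u_ij L_{u_i} is subtracted with the characteristic.\<close>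
  note sym = transpose_eq_selfD[OF q, of 2 1] transpose_eq_selfD[OF q, of 3 1] transpose_eq_selfD[OF q, of 3 2]
  have "prolong1 S L (X, u, p) + L (X, u, p) * (\<Sum>i\<in>UNIV. D0 i (xi S) (X, u, p) $ i) = Div \<phi> (X, u, p, q)"
    using N q by (simp add: noether_identity_def)
  then have "(\<Sum>i\<in>UNIV. D1 i \<phi> (X, u, p, q) $ i) =
      (\<Sum>i\<in>UNIV. x $ i * ?L (axis i 1, 0, 0)) + eta S (X, u) * ?L (0, 1, 0)
      + (\<Sum>i\<in>UNIV. (D0 i (eta S) (X, u, p) - (\<Sum>j\<in>UNIV. D0 i (xi S) (X, u, p) $ j * p $ j)) * P i (X, u, p))
      + L (X, u, p) * (\<Sum>i\<in>UNIV. D0 i (xi S) (X, u, p) $ i)"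
    by (simp add: prolong1_def Div_def lin[of "xi S (X, u)"] zeta1_def x_def)
  \<comment> \<open>After inserting the Noether identity for D_i \<phi>^i, the terms with L_{x^i}, L
    D_i \<xi>^i and the prolongation coefficients cancel. The u-derivative of L keeps the factor
    \<xi>^i u_i - \<eta> = -Q.\<close>
  then have "Div J (X, u, p, q) = Q * ((\<Sum>i\<in>UNIV. D1 i (P i) (X, u, p, q)) - ?L (0, 1, 0))"
    unfolding Div_def J_def[symmetric] DJ DL sum_subtractf
    by (simp add: sum_3 sym Q_def algebra_simps)
  then show ?thesis
    by (simp add: J_def Q_def x_def P_def[abs_def])
qed

text \<open>Jets of actual smooth functions lie in the symmetric locus, so identities stated on
  symmetric jets apply to solutions.\<close>

lemma jet2_of_symmetric:
  fixes u :: "real^3 \<Rightarrow> real"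
  assumes "smooth u"
  shows "transpose (\<chi> i j. pd j (pd i u) X) = (\<chi> i j. pd j (pd i u) X)"
  by (simp add: transpose_def pd_commute[OF assms])

section \<open>The Lagrangian of the Kohn-Laplace equation\<close>

text \<open>The Lagrangian is half the squared length of the horizontal gradient (u_x + 2y u_t, u_y
  - 2x u_t). The coefficients of \<open>c\<close> are the momenta L_{u_i}: these two components and
  2y times the first minus 2x times the second.\<close>

lemma kl_lagrangian_has_derivative:
  "(kl_lagrangian has_derivative (\<lambda>(a, b, c).
      4 * (X$1 * a$1 + X$2 * a$2) * (p$3)^2 + 2 * a$2 * p$1 * p$3 - 2 * a$1 * p$2 * p$3
      + c$1 * (p$1 + 2 * X$2 * p$3) + c$2 * (p$2 - 2 * X$1 * p$3)
      + c$3 * (4 * ((X$1)^2 + (X$2)^2) * p$3 + 2 * X$2 * p$1 - 2 * X$1 * p$2))) (at (X, u, p))"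
proof -
  have x: "((\<lambda>z. fst z $ k) has_derivative (\<lambda>h. fst h $ k)) F"
    and p: "((\<lambda>z. snd (snd z) $ k) has_derivative (\<lambda>h. snd (snd h) $ k)) F"
    for k :: 3 and F :: "jet1 filter"
    by (intro has_derivative_nth has_derivative_fst has_derivative_snd has_derivative_ident)+
  show ?thesis
    unfolding kl_lagrangian_def on_jet1_def case_prod_beta
    by (rule has_derivative_eq_rhs, (rule has_derivative_add has_derivative_diff has_derivative_mult
        has_derivative_power has_derivative_const x p)+) (simp add: fun_eq_iff algebra_simps)
qed

lemma smooth_kl_lagrangian: "smooth kl_lagrangian"
  unfolding kl_lagrangian_def on_jet1_def case_prod_beta by (intro smooth_intros)

text \<open>The operator is linear in the second-order coordinates, so its derivative in that
  direction is the operator applied to the increment \<open>d\<close>.\<close>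

lemma kohn_laplace_has_derivative:
  "(kohn_laplace has_derivative (\<lambda>(a, b, c, d).
      8 * (X$1 * a$1 + X$2 * a$2) * q$3$3 + 4 * a$2 * q$1$3 - 4 * a$1 * q$2$3
      + kohn_laplace (X, u, p, d))) (at (X, u, p, q))"
proof -
  have x: "((\<lambda>z. fst z $ k) has_derivative (\<lambda>h. fst h $ k)) F" for k :: 3 and F :: "jet2 filter"
    by (intro has_derivative_nth has_derivative_fst has_derivative_ident)
  have q: "((\<lambda>z. snd (snd (snd z)) $ k $ l) has_derivative (\<lambda>h. snd (snd (snd h)) $ k $ l)) F"
    for k l :: 3 and F :: "jet2 filter"
    by (intro has_derivative_nth has_derivative_snd has_derivative_ident)
  show ?thesis
    unfolding kohn_laplace_def case_prod_beta Let_def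
    by (rule has_derivative_eq_rhs, (rule has_derivative_add has_derivative_diff has_derivative_mult
        has_derivative_power has_derivative_const x q)+) (simp add: fun_eq_iff algebra_simps)
qed

text \<open>The coefficients in the momenta are constant in the direction of their own D_i, so no
  first-order terms arise. Each mixed term of the operator comes half from D_t and half from D_x or
  D_y, which symmetry of \<open>q\<close> combines.\<close>

lemma kl_euler_lagrange:
  assumes "transpose q = q"
  shows "(\<Sum>i\<in>UNIV. D1 i (\<lambda>z. frechet_derivative kl_lagrangian (at z) (0, 0, axis i 1)) (X, u, p, q))
      - frechet_derivative kl_lagrangian (at (X, u, p)) (0, 1, 0) = kohn_laplace (X, u, p, q)"
proof -
  note d = frechet_derivative_at[OF kl_lagrangian_has_derivative, symmetric]
  note sym = transpose_eq_selfD[OF assms, of 3 1] transpose_eq_selfD[OF assms, of 3 2]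
  note x = has_derivative_nth[OF has_derivative_fst[OF has_derivative_ident]]
  note p = has_derivative_nth[OF has_derivative_snd[OF has_derivative_snd[OF has_derivative_ident]]]
  note rules = has_derivative_add has_derivative_diff has_derivative_mult has_derivative_power has_derivative_const x p
  have "D1 1 (\<lambda>z. frechet_derivative kl_lagrangian (at z) (0, 0, axis 1 1)) (X, u, p, q) =
      D1 1 (\<lambda>z. snd (snd z) $ 1 + 2 * fst z $ 2 * snd (snd z) $ 3) (X, u, p, q)"
    by (rule arg_cong[where f = "\<lambda>F. D1 1 F (X, u, p, q)"]) (auto simp: fun_eq_iff d axis_def)
  also have "\<dots> = q $ 1 $ 1 + 2 * X $ 2 * q $ 1 $ 3"
    by (rule trans[OF D1_eqI], (rule rules)+) (simp add: axis_def)
  finally have 1: "D1 1 (\<lambda>z. frechet_derivative kl_lagrangian (at z) (0, 0, axis 1 1)) (X, u, p, q) =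
      q $ 1 $ 1 + 2 * X $ 2 * q $ 1 $ 3" .
  have "D1 2 (\<lambda>z. frechet_derivative kl_lagrangian (at z) (0, 0, axis 2 1)) (X, u, p, q) =
      D1 2 (\<lambda>z. snd (snd z) $ 2 - 2 * fst z $ 1 * snd (snd z) $ 3) (X, u, p, q)"
    by (rule arg_cong[where f = "\<lambda>F. D1 2 F (X, u, p, q)"]) (auto simp: fun_eq_iff d axis_def)
  also have "\<dots> = q $ 2 $ 2 - 2 * X $ 1 * q $ 2 $ 3"
    by (rule trans[OF D1_eqI], (rule rules)+) (simp add: axis_def)
  finally have 2: "D1 2 (\<lambda>z. frechet_derivative kl_lagrangian (at z) (0, 0, axis 2 1)) (X, u, p, q) =
      q $ 2 $ 2 - 2 * X $ 1 * q $ 2 $ 3" .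
  have "D1 3 (\<lambda>z. frechet_derivative kl_lagrangian (at z) (0, 0, axis 3 1)) (X, u, p, q) =
      D1 3 (\<lambda>z. 4 * ((fst z $ 1)\<^sup>2 + (fst z $ 2)\<^sup>2) * snd (snd z) $ 3
        + 2 * fst z $ 2 * snd (snd z) $ 1 - 2 * fst z $ 1 * snd (snd z) $ 2) (X, u, p, q)"
    by (rule arg_cong[where f = "\<lambda>F. D1 3 F (X, u, p, q)"]) (auto simp: fun_eq_iff d axis_def)
  also have "\<dots> = 4 * ((X $ 1)\<^sup>2 + (X $ 2)\<^sup>2) * q $ 3 $ 3 + 2 * X $ 2 * q $ 3 $ 1 - 2 * X $ 1 * q $ 3 $ 2"
    by (rule trans[OF D1_eqI], (rule rules)+) (simp add: axis_def)
  finally have 3: "D1 3 (\<lambda>z. frechet_derivative kl_lagrangian (at z) (0, 0, axis 3 1)) (X, u, p, q) =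
      4 * ((X $ 1)\<^sup>2 + (X $ 2)\<^sup>2) * q $ 3 $ 3 + 2 * X $ 2 * q $ 3 $ 1 - 2 * X $ 1 * q $ 3 $ 2" .
  show ?thesis
    by (simp add: sum_3 1 2 3 d sym kohn_laplace_def Let_def)
qed

section \<open>Fields affine in u\<close>

text \<open>
  All the symmetries of the theorem have this form: \<open>h = 0\<close> for the geometric ones, while
  \<open>\<xi> = 0\<close>, \<open>g = 0\<close> and \<open>h = \<beta>\<close> for the superposition field.
\<close>

definition affine_field :: "(real^3 \<Rightarrow> real^3) \<Rightarrow> (real^3 \<Rightarrow> real) \<Rightarrow> (real^3 \<Rightarrow> real) \<Rightarrow> field0" where
  "affine_field \<xi> g h = (\<lambda>(X, u). (\<xi> X, g X * u + h X))"

lemma xi_affine_field: "xi (affine_field \<xi> g h) z = \<xi> (fst z)"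
  by (simp add: xi_def affine_field_def case_prod_beta)

lemma eta_affine_field: "eta (affine_field \<xi> g h) z = g (fst z) * snd z + h (fst z)"
  by (simp add: eta_def affine_field_def case_prod_beta)

context
  fixes \<xi> :: "real^3 \<Rightarrow> real^3" and g h :: "real^3 \<Rightarrow> real"
  assumes smooth: "smooth \<xi>" "smooth g" "smooth h"
begin

lemma smooth_affine_field: "smooth (affine_field \<xi> g h)"
  unfolding affine_field_def case_prod_beta
  by (intro smooth_intros smooth_comp_fst[OF smooth(1)] smooth_comp_fst[OF smooth(2)] smooth_comp_fst[OF smooth(3)])

lemma D0_xi_affine_field: "D0 i (xi (affine_field \<xi> g h)) (X, u, p) = pd i \<xi> X"
  unfolding xi_affine_field[abs_def]
  by (subst D0_eqI[OF smooth_has_derivative_fst[OF smooth(1)]]) (simp add: pd_def)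

lemma D0_eta_affine_field:
  "D0 i (eta (affine_field \<xi> g h)) (X, u, p) = pd i g X * u + g X * p $ i + pd i h X"
  unfolding eta_affine_field[abs_def]
  by (subst D0_eqI[OF has_derivative_add[OF
        has_derivative_mult[OF smooth_has_derivative_fst[OF smooth(2)] has_derivative_snd[OF has_derivative_ident]]
        smooth_has_derivative_fst[OF smooth(3)]]])
    (simp add: pd_def)

lemma zeta1_affine_field:
  "zeta1 (affine_field \<xi> g h) (X, u, p) =
    (\<chi> i. pd i g X * u + g X * p $ i + pd i h X - (\<Sum>j\<in>UNIV. pd i \<xi> X $ j * p $ j))"
  by (simp add: zeta1_def D0_xi_affine_field D0_eta_affine_field)

text \<open>Terms in \<open>q $ j\<close> arise from D_j acting on the coordinates u_k in the first
  coefficients; the last sum is the correction in the definition of the second prolongation.\<close>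

lemma zeta2_affine_field:
  "zeta2 (affine_field \<xi> g h) (X, u, p, q) =
    (\<chi> i j. pd j (pd i g) X * u + pd i g X * p $ j + pd j g X * p $ i + g X * q $ j $ i + pd j (pd i h) X
      - (\<Sum>k\<in>UNIV. pd j (pd i \<xi>) X $ k * p $ k + pd i \<xi> X $ k * q $ j $ k)
      - (\<Sum>k\<in>UNIV. q $ i $ k * pd j \<xi> X $ k))"
proof -
  have z: "zeta1 (affine_field \<xi> g h) = (\<lambda>z. \<chi> i. pd i g (fst z) * fst (snd z) + g (fst z) * snd (snd z) $ i
      + pd i h (fst z) - (\<Sum>j\<in>UNIV. pd i \<xi> (fst z) $ j * snd (snd z) $ j))"
    by (auto simp: fun_eq_iff zeta1_affine_field)
  have s: "smooth (\<lambda>z :: jet1. g (fst z))" "smooth (\<lambda>z :: jet1. pd i g (fst z))"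
    "smooth (\<lambda>z :: jet1. pd i h (fst z))" "smooth (\<lambda>z :: jet1. pd i \<xi> (fst z))" for i
    using smooth by (auto intro: smooth_comp_fst smooth_pd)
  have "smooth (zeta1 (affine_field \<xi> g h))"
    unfolding z by (intro smooth_intros s)
  then have "D1 j (zeta1 (affine_field \<xi> g h)) (X, u, p, q) $ i
      = D1 j (\<lambda>z. zeta1 (affine_field \<xi> g h) z $ i) (X, u, p, q)" for i j
    by (rule D1_nth)
  moreover have "D1 j (\<lambda>z. zeta1 (affine_field \<xi> g h) z $ i) (X, u, p, q) =
      pd j (pd i g) X * u + pd i g X * p $ j + pd j g X * p $ i + g X * q $ j $ i + pd j (pd i h) X
      - (\<Sum>k\<in>UNIV. pd j (pd i \<xi>) X $ k * p $ k + pd i \<xi> X $ k * q $ j $ k)" for i j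
  proof -
    let ?z = "(X, u, p)"
    have f: "((\<lambda>z. f (fst z)) has_derivative (\<lambda>h. frechet_derivative f (at X) (fst h))) (at ?z)"
      if "smooth f" for f :: "real^3 \<Rightarrow> 'b::real_normed_vector"
      using smooth_has_derivative_fst[OF that, of ?z] by simp
    have u: "((\<lambda>z. fst (snd z)) has_derivative (\<lambda>h. fst (snd h))) (at ?z)"
      by (intro has_derivative_fst has_derivative_snd has_derivative_ident)
    have p: "((\<lambda>z. snd (snd z) $ k) has_derivative (\<lambda>h. snd (snd h) $ k)) (at ?z)" for k
      by (intro has_derivative_nth has_derivative_snd has_derivative_ident)
    note d = has_derivative_diff[OF
        has_derivative_add[OF has_derivative_add[OF
            has_derivative_mult[OF f[OF smooth_pd[OF smooth(2)]] u]
            has_derivative_mult[OF f[OF smooth(2)] p]]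
          f[OF smooth_pd[OF smooth(3)]]]
        has_derivative_sum[OF has_derivative_mult[OF has_derivative_nth[OF f[OF smooth_pd[OF smooth(1)]]] p]]]
    show ?thesis
      unfolding z vec_lambda_beta
      by (subst D1_eqI[OF d]) (simp add: pd_def add_ac)
  qed
  ultimately show ?thesis
    by (simp add: zeta2_def D0_xi_affine_field vec_eq_iff)
qed

end

text \<open>
  The functions \<open>\<phi>\<close> in the Noether identities: \<open>f\<close> occurs for the fields \<open>V\<^sub>1, V\<^sub>2, V\<^sub>3\<close>, and \<open>k\<close> for \<open>W\<^sub>\<beta>\<close>.
\<close>

definition quadratic_flux :: "(real^3 \<Rightarrow> real^3) \<Rightarrow> (real^3 \<Rightarrow> real^3) \<Rightarrow> jet1 \<Rightarrow> real^3" where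
  "quadratic_flux f k = (\<lambda>(X, u, p). u^2 *\<^sub>R f X + u *\<^sub>R k X)"

context
  fixes f k :: "real^3 \<Rightarrow> real^3"
  assumes f: "smooth f" and k: "smooth k"
begin

lemma smooth_quadratic_flux: "smooth (quadratic_flux f k)"
  unfolding quadratic_flux_def case_prod_beta
  by (intro smooth_intros smooth_comp_fst[OF f] smooth_comp_fst[OF k])

text \<open>A flux of order 0 has a divergence of order 1, so the Noether identity becomes a
  comparison in \<open>X\<close>, \<open>u\<close>, \<open>p\<close> alone.\<close>

lemma Div_quadratic_flux:
  "Div (quadratic_flux f k) (X, u, p, q) =
    (\<Sum>i\<in>UNIV. u^2 * pd i f X $ i + 2 * u * p $ i * f X $ i + u * pd i k X $ i + p $ i * k X $ i)"
proof -
  have u: "((\<lambda>z. fst (snd z)) has_derivative (\<lambda>h. fst (snd h))) (at (X, u, p))"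
    by (intro has_derivative_fst has_derivative_snd has_derivative_ident)
  note d = has_derivative_add[OF
      has_derivative_scaleR[OF has_derivative_power[OF u] smooth_has_derivative_fst[OF f]]
      has_derivative_scaleR[OF u smooth_has_derivative_fst[OF k]]]
  have "D1 i (quadratic_flux f k) (X, u, p, q) $ i =
      u^2 * pd i f X $ i + 2 * u * p $ i * f X $ i + u * pd i k X $ i + p $ i * k X $ i" for i
    unfolding quadratic_flux_def case_prod_beta by (subst D1_eqI[OF d]) (simp add: pd_def)
  then show ?thesis
    by (simp add: Div_def)
qed

end

section \<open>Explicit prolongations and currents, and the criterion for conservation laws\<close>

lemma prolong1_kl_lagrangian:
  "prolong1 S kl_lagrangian (X, u, p) =
    4 * (X$1 * xi S (X, u) $ 1 + X$2 * xi S (X, u) $ 2) * (p$3)^2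
    + 2 * xi S (X, u) $ 2 * p$1 * p$3 - 2 * xi S (X, u) $ 1 * p$2 * p$3
    + zeta1 S (X, u, p) $ 1 * (p$1 + 2 * X$2 * p$3) + zeta1 S (X, u, p) $ 2 * (p$2 - 2 * X$1 * p$3)
    + zeta1 S (X, u, p) $ 3 * (4 * ((X$1)^2 + (X$2)^2) * p$3 + 2 * X$2 * p$1 - 2 * X$1 * p$2)"
  by (simp add: prolong1_def frechet_derivative_at[OF kl_lagrangian_has_derivative, symmetric])

lemma prolong2_kohn_laplace:
  "prolong2 S kohn_laplace (X, u, p, q) =
    8 * (X$1 * xi S (X, u) $ 1 + X$2 * xi S (X, u) $ 2) * q$3$3
    + 4 * xi S (X, u) $ 2 * q$1$3 - 4 * xi S (X, u) $ 1 * q$2$3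
    + kohn_laplace (X, u, p, zeta2 S (X, u, p, q))"
  by (simp add: prolong2_def frechet_derivative_at[OF kohn_laplace_has_derivative, symmetric])

lemma noether_current_kl_lagrangian:
  fixes S X u p
  defines "Q \<equiv> eta S (X, u) - (\<Sum>j\<in>UNIV. xi S (X, u) $ j * p $ j)"
  shows "noether_current kl_lagrangian S \<phi> (X, u, p) =
    kl_lagrangian (X, u, p) *\<^sub>R xi S (X, u)
    + Q *\<^sub>R vector [p$1 + 2 * X$2 * p$3, p$2 - 2 * X$1 * p$3,
        4 * ((X$1)^2 + (X$2)^2) * p$3 + 2 * X$2 * p$1 - 2 * X$1 * p$2]
    - \<phi> (X, u, p)"
  by (simp add: noether_current_def frechet_derivative_at[OF kl_lagrangian_has_derivative, symmetric]
      vec_eq_iff forall_3 axis_def Q_def)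

text \<open>Reduces each law to identities between explicit expressions on jets. A prolonged
  operator that is a multiple \<mu> of the operator vanishes on the equation, which is the Lie
  condition.\<close>

lemma kl_conservation_lawI:
  assumes smooth: "smooth \<xi>" "smooth g" "smooth h" "smooth f" "smooth k"
    and S: "S = affine_field \<xi> g h"
    and lie: "\<And>X u p q. transpose q = q \<Longrightarrow>
      prolong2 (affine_field \<xi> g h) kohn_laplace (X, u, p, q) = \<mu> X * kohn_laplace (X, u, p, q)"
    and noether: "\<And>X u p.
      prolong1 (affine_field \<xi> g h) kl_lagrangian (X, u, p) + kl_lagrangian (X, u, p) * (\<Sum>i\<in>UNIV. pd i \<xi> X $ i)
      = (\<Sum>i\<in>UNIV. u^2 * pd i f X $ i + 2 * u * p $ i * f X $ i + u * pd i k X $ i + p $ i * k X $ i)"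
    and current: "\<And>X u p. A (X, u, p) =
      noether_current kl_lagrangian (affine_field \<xi> g h) (quadratic_flux f k) (X, u, p)"
  shows "kl_conservation_law S A"
proof -
  have S': "smooth S"
    using smooth S by (simp add: smooth_affine_field)
  have N: "noether_identity kl_lagrangian S (quadratic_flux f k)"
    unfolding noether_identity_def S
    by (simp add: smooth_quadratic_flux smooth Div_quadratic_flux D0_xi_affine_field noether)
  have A: "A = noether_current kl_lagrangian S (quadratic_flux f k)"
    by (auto simp: fun_eq_iff current S)
  \<comment> \<open>On the jet of a solution the divergence is the characteristic times the
    Kohn-Laplace operator, hence zero.\<close>
  have "Div A (jet2_of u X) = 0" if "kl_solution u" for u X
  proof -
    have u: "smooth u" "kohn_laplace (jet2_of u X) = 0"
      using that by (auto simp: kl_solution_def)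
    show ?thesis
      using u(2) unfolding A jet2_of_def
      by (simp add: Div_noether_current[OF S' smooth_kl_lagrangian N jet2_of_symmetric[OF u(1)]]
          kl_euler_lagrange[OF jet2_of_symmetric[OF u(1)]])
  qed
  moreover have "lie_point_symmetry kohn_laplace S"
    using S' lie by (simp add: lie_point_symmetry_def S)
  ultimately show ?thesis
    using N A unfolding kl_conservation_law_def noether_symmetry_def by blast
qed

lemma kohn_laplace_apply:
  "kohn_laplace (X, u, p, q) =
    q$1$1 + q$2$2 + 4 * ((X$1)^2 + (X$2)^2) * q$3$3 + 4 * X$2 * q$1$3 - 4 * X$1 * q$2$3"
  by (simp add: kohn_laplace_def Let_def)

lemma kl_lagrangian_apply:
  "kl_lagrangian (X, u, p) = 1/2 * (p$1)^2 + 1/2 * (p$2)^2 + 2 * ((X$1)^2 + (X$2)^2) * (p$3)^2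
    + 2 * X$2 * p$1 * p$3 - 2 * X$1 * p$2 * p$3"
  by (simp add: kl_lagrangian_def on_jet1_def)

text \<open>The rules \<open>smooth_intros\<close> are included to discharge the smoothness premises
  of \<open>pd_simps\<close>.\<close>

lemmas kl_simps = kohn_laplace_apply kl_lagrangian_apply prolong1_kl_lagrangian prolong2_kohn_laplace noether_current_kl_lagrangian
  xi_affine_field eta_affine_field zeta1_affine_field zeta2_affine_field
  quadratic_flux_def sum_3 pd_simps smooth_intros

section \<open>The symmetries and their currents\<close>

text \<open>Numeral powers are unfolded into products and fractions distributed over sums, so both
  sides of a polynomial identity expand to the same form.\<close>

lemmas ring_normalize = algebra_simps power_numeral_reduce add_divide_distrib diff_divide_distrib

text \<open>Neither the operator nor the Lagrangian depends on t, so flux and multiplier are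
  zero.\<close>

lemma conservation_law_T: "kl_conservation_law field_T vec_tau"
proof (rule kl_conservation_lawI[where \<xi> = "\<lambda>X. vector [0, 0, 1]"
    and g = "\<lambda>X. 0" and h = "\<lambda>X. 0"
    and f = "\<lambda>X. 0" and k = "\<lambda>X. 0" and \<mu> = "\<lambda>X. 0"], goal_cases)
  \<comment> \<open>Goals 1 to 5 are smoothness conditions, left to the closing method. Goals 6 to 9
    identify the field, then give the Lie condition, the Noether identity and the current.\<close>
  case 6
  show ?case
    by (simp add: field_T_def on_jet0_def affine_field_def fun_eq_iff)
next
  case (7 X u p q)
  note sym = transpose_eq_selfD[OF 7, of 2 1] transpose_eq_selfD[OF 7, of 3 1] transpose_eq_selfD[OF 7, of 3 2]
  show ?case
    by (simp add: kl_simps sym ring_normalize)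
next
  case (8 X u p)
  show ?case
    by (simp add: kl_simps ring_normalize)
next
  case (9 X u p)
  show ?case
    by (simp add: kl_simps vec_tau_def on_jet1_def vec_eq_iff forall_3 ring_normalize)
qed (intro smooth_intros)+

text \<open>The rotation field is divergence free, and its commutators rotate the frame X =
  \<partial>_x + 2y \<partial>_t, Y = \<partial>_y - 2x \<partial>_t: they are [R, X] = Y and [R, Y]
  = -X. This preserves the sum of squares.\<close>

lemma conservation_law_R: "kl_conservation_law field_R vec_sigma"
proof (rule kl_conservation_lawI[where \<xi> = "\<lambda>X. vector [X$2, - X$1, 0]"
    and g = "\<lambda>X. 0" and h = "\<lambda>X. 0"
    and f = "\<lambda>X. 0" and k = "\<lambda>X. 0" and \<mu> = "\<lambda>X. 0"], goal_cases)
  case 6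
  show ?case
    by (simp add: field_R_def on_jet0_def affine_field_def fun_eq_iff)
next
  case (7 X u p q)
  note sym = transpose_eq_selfD[OF 7, of 2 1] transpose_eq_selfD[OF 7, of 3 1] transpose_eq_selfD[OF 7, of 3 2]
  show ?case
    by (simp add: kl_simps sym ring_normalize)
next
  case (8 X u p)
  show ?case
    by (simp add: kl_simps ring_normalize)
next
  case (9 X u p)
  show ?case
    by (simp add: kl_simps vec_sigma_def on_jet1_def vec_eq_iff forall_3 ring_normalize)
qed (intro smooth_intros)+

text \<open>This field and the one for \<open>field_Y\<close> are divergence free and commute with
  both horizontal fields \<partial>_x + 2y \<partial>_t and \<partial>_y - 2x \<partial>_t, hence
  the zero flux and multiplier.\<close>

lemma conservation_law_X: "kl_conservation_law field_X vec_chi"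
proof (rule kl_conservation_lawI[where \<xi> = "\<lambda>X. vector [1, 0, - 2 * X$2]"
    and g = "\<lambda>X. 0" and h = "\<lambda>X. 0"
    and f = "\<lambda>X. 0" and k = "\<lambda>X. 0" and \<mu> = "\<lambda>X. 0"], goal_cases)
  case 6
  show ?case
    by (simp add: field_X_def on_jet0_def affine_field_def fun_eq_iff)
next
  case (7 X u p q)
  note sym = transpose_eq_selfD[OF 7, of 2 1] transpose_eq_selfD[OF 7, of 3 1] transpose_eq_selfD[OF 7, of 3 2]
  show ?case
    by (simp add: kl_simps sym ring_normalize)
next
  case (8 X u p)
  show ?case
    by (simp add: kl_simps ring_normalize)
next
  case (9 X u p)
  show ?case
    by (simp add: kl_simps vec_chi_def on_jet1_def vec_eq_iff forall_3 ring_normalize)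
qed (intro smooth_intros)+

lemma conservation_law_Y: "kl_conservation_law field_Y vec_upsilon"
proof (rule kl_conservation_lawI[where \<xi> = "\<lambda>X. vector [0, 1, 2 * X$1]"
    and g = "\<lambda>X. 0" and h = "\<lambda>X. 0"
    and f = "\<lambda>X. 0" and k = "\<lambda>X. 0" and \<mu> = "\<lambda>X. 0"], goal_cases)
  case 6
  show ?case
    by (simp add: field_Y_def on_jet0_def affine_field_def fun_eq_iff)
next
  case (7 X u p q)
  note sym = transpose_eq_selfD[OF 7, of 2 1] transpose_eq_selfD[OF 7, of 3 1] transpose_eq_selfD[OF 7, of 3 2]
  show ?case
    by (simp add: kl_simps sym ring_normalize)
next
  case (8 X u p)
  show ?case
    by (simp add: kl_simps ring_normalize)
next
  case (9 X u p)
  show ?case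
    by (simp add: kl_simps vec_upsilon_def on_jet1_def vec_eq_iff forall_3 ring_normalize)
qed (intro smooth_intros)+

text \<open>Here g = -(div \<xi>)/4 balances the scaling of the Lagrangian, and \<mu> = 3g. The
  surviving terms of the Noether identity are u times g_i L_{u_i}; matching them with 2u f_i u_i
  makes \<open>f\<close> half the momentum vector evaluated at the gradient of g. Its divergence is
  half the Kohn-Laplacian of g, which is zero.\<close>

lemma conservation_law_V1: "kl_conservation_law field_V1 vec_A"
proof (rule kl_conservation_lawI[where \<xi> = "\<lambda>X. vector
      [X$1*X$3 - (X$1)^2*X$2 - (X$2)^3, X$2*X$3 + (X$1)^3 + X$1*(X$2)^2, (X$3)^2 - ((X$1)^2 + (X$2)^2)^2]"
    and g = "\<lambda>X. - X$3" and h = "\<lambda>X. 0"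
    and f = "\<lambda>X. vector [- X$2, X$1, - 2 * ((X$1)^2 + (X$2)^2)]" and k = "\<lambda>X. 0" and \<mu> = "\<lambda>X. - 3 * X$3"], goal_cases)
  case 6
  show ?case
    by (simp add: field_V1_def on_jet0_def affine_field_def fun_eq_iff)
next
  case (7 X u p q)
  note sym = transpose_eq_selfD[OF 7, of 2 1] transpose_eq_selfD[OF 7, of 3 1] transpose_eq_selfD[OF 7, of 3 2]
  show ?case
    by (simp add: kl_simps sym ring_normalize)
next
  case (8 X u p)
  show ?case
    by (simp add: kl_simps ring_normalize)
next
  case (9 X u p)
  show ?case
    by (simp add: kl_simps vec_A_def on_jet1_def vec_eq_iff forall_3 ring_normalize)
qed (intro smooth_intros)+

text \<open>The same recipe with g = 2y: \<open>f\<close> is half the momentum vector of g, and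
  \<mu> = 3g = 6y.\<close>

lemma conservation_law_V2: "kl_conservation_law field_V2 vec_B"
proof (rule kl_conservation_lawI[where \<xi> = "\<lambda>X. vector
      [X$3 - 4*X$1*X$2, 3*(X$1)^2 - (X$2)^2, - (2*X$2*X$3 + 2*(X$1)^3 + 2*X$1*(X$2)^2)]"
    and g = "\<lambda>X. 2 * X$2" and h = "\<lambda>X. 0"
    and f = "\<lambda>X. vector [0, 1, - 2 * X$1]" and k = "\<lambda>X. 0" and \<mu> = "\<lambda>X. 6 * X$2"], goal_cases)
  case 6
  show ?case
    by (simp add: field_V2_def on_jet0_def affine_field_def fun_eq_iff)
next
  case (7 X u p q)
  note sym = transpose_eq_selfD[OF 7, of 2 1] transpose_eq_selfD[OF 7, of 3 1] transpose_eq_selfD[OF 7, of 3 2]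
  show ?case
    by (simp add: kl_simps sym ring_normalize)
next
  case (8 X u p)
  show ?case
    by (simp add: kl_simps ring_normalize)
next
  case (9 X u p)
  show ?case
    by (simp add: kl_simps vec_B_def on_jet1_def vec_eq_iff forall_3 ring_normalize)
qed (intro smooth_intros)+

text \<open>The same recipe with g = -2x gives \<open>f\<close> = (-1, 0, -2y) and \<mu> =
  -6x.\<close>

lemma conservation_law_V3: "kl_conservation_law field_V3 vec_C"
proof (rule kl_conservation_lawI[where \<xi> = "\<lambda>X. vector
      [(X$1)^2 - 3*(X$2)^2, X$3 + 4*X$1*X$2, 2*X$1*X$3 - 2*(X$1)^2*X$2 - 2*(X$2)^3]"
    and g = "\<lambda>X. - 2 * X$1" and h = "\<lambda>X. 0"
    and f = "\<lambda>X. vector [- 1, 0, - 2 * X$2]" and k = "\<lambda>X. 0" and \<mu> = "\<lambda>X. - 6 * X$1"], goal_cases)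
  case 6
  show ?case
    by (simp add: field_V3_def on_jet0_def affine_field_def fun_eq_iff)
next
  case (7 X u p q)
  note sym = transpose_eq_selfD[OF 7, of 2 1] transpose_eq_selfD[OF 7, of 3 1] transpose_eq_selfD[OF 7, of 3 2]
  show ?case
    by (simp add: kl_simps sym ring_normalize)
next
  case (8 X u p)
  show ?case
    by (simp add: kl_simps ring_normalize)
next
  case (9 X u p)
  show ?case
    by (simp add: kl_simps vec_C_def on_jet1_def vec_eq_iff forall_3 ring_normalize)
qed (intro smooth_intros)+

text \<open>Superposition by a solution. The flux coefficient \<open>k\<close> is the momentum
  vector evaluated at the gradient of \<beta>; its divergence is the Kohn-Laplacian of \<beta>, so
  the term in u of the Noether identity vanishes.\<close>

lemma conservation_law_W:
  assumes \<beta>: "kl_solution \<beta>"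
  shows "kl_conservation_law (field_W \<beta>) (vec_W \<beta>)"
proof -
  have s: "smooth \<beta>" and kl: "\<And>X. kohn_laplace (jet2_of \<beta> X) = 0"
    using \<beta> by (auto simp: kl_solution_def)
  note mixed = pd_commute[OF s, of 2 1] pd_commute[OF s, of 3 1] pd_commute[OF s, of 3 2]
  \<comment> \<open>The equation is solved for one second derivative, with mixed derivatives in a
    fixed order, so that it can serve as a rewrite rule.\<close>
  have eq: "pd 1 (pd 1 \<beta>) X = 4 * X$1 * pd 2 (pd 3 \<beta>) X - 4 * X$2 * pd 1 (pd 3 \<beta>) X
      - 4 * ((X$1)^2 + (X$2)^2) * pd 3 (pd 3 \<beta>) X - pd 2 (pd 2 \<beta>) X" for X
    using kl[of X] by (simp add: jet2_of_def kohn_laplace_apply mixed)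
  show ?thesis
  proof (rule kl_conservation_lawI[where \<xi> = "\<lambda>X. 0" and g = "\<lambda>X. 0" and h = \<beta>
        and f = "\<lambda>X. 0" and k = "\<lambda>X. vector [pd 1 \<beta> X + 2 * X$2 * pd 3 \<beta> X,
          pd 2 \<beta> X - 2 * X$1 * pd 3 \<beta> X,
          4 * ((X$1)^2 + (X$2)^2) * pd 3 \<beta> X + 2 * X$2 * pd 1 \<beta> X - 2 * X$1 * pd 2 \<beta> X]"
        and \<mu> = "\<lambda>X. 0"], goal_cases)
    case 3
    show ?case by (rule s)
  next
    case 5
    show ?case by (intro smooth_intros s)
  next
    case 6
    show ?case
      by (simp add: field_W_def affine_field_def)
  next
    \<comment> \<open>With \<xi> = 0 and g = 0 the second prolongation coefficients are the Hessian
      of \<beta>, so the left-hand side is its Kohn-Laplacian and \<mu> = 0 fits.\<close>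
    case (7 X u p q)
    show ?case
      by (simp add: kl_simps s mixed eq ring_normalize)
  next
    case (8 X u p)
    show ?case
      by (simp add: kl_simps s mixed eq ring_normalize)
  next
    case (9 X u p)
    show ?case
      by (simp add: kl_simps s vec_W_def Let_def vec_eq_iff forall_3 ring_normalize)
  qed (intro smooth_intros)+
qed

theorem theorem6:
  shows "kl_conservation_law field_T vec_tau
    \<and> kl_conservation_law field_R vec_sigma
    \<and> kl_conservation_law field_X vec_chi
    \<and> kl_conservation_law field_Y vec_upsilon
    \<and> kl_conservation_law field_V1 vec_A
    \<and> kl_conservation_law field_V2 vec_B
    \<and> kl_conservation_law field_V3 vec_C
    \<and> (\<forall>\<beta>. kl_solution \<beta> \<longrightarrow> kl_conservation_law (field_W \<beta>) (vec_W \<beta>))"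
  using conservation_law_T conservation_law_R conservation_law_X conservation_law_Y
    conservation_law_V1 conservation_law_V2 conservation_law_V3 conservation_law_W
  by blast

end
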